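(* Let $A\colon\mathbb{N}\to(0,\infty)$ be a non-decreasing function. For $i\in\mathbb{N}$ set $\mathscr{A}(i)=\sum_{z=1}^{i}\frac{1}{A(z)}$, and set $a_0=0$ and $a_i=\frac{i!}{(\mathscr{A}(i))^{i}}$ for $i\in\mathbb{N}$. Consider the continuous-time frog model on $\mathbb{Z}$ with initial distribution $\mu$. (i) Assume that $$\sum_{z=1}^\infty\frac{1}{A(z)}=\infty\qquad\text{and}\qquad \sum_{i=0}^\infty\mu\left(\left[a_i,\infty\right)\right)<\infty.$$ Then almost surely no explosion occurs. (ii) Assume that $$\sum_{z=1}^\infty\frac{1}{A(z)}<\infty$$ and that there exists $\rho>1$ such that $$\sum_{m=1}^\infty\prod_{i=1}^m\mu\big([0,A(m)^{\rho i}]\big)<\infty.$$ Then an explosion occurs almost surely.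
   Context: $\mathbb{N}=\{1,2,3,\dots\}$, $\mathbb{Z}_+=\mathbb{N}\cup\{0\}$. $\mu$ is a probability measure with $\mu(\mathbb{Z}_+)=1$, and it is assumed throughout that $\mu(\{0\})<1$. Continuous-time frog model on $\mathbb{Z}$ with initial distribution $\mu$: $(\eta(x))_{x\in\mathbb{Z}}$ are independent random variables with common distribution $\mu$. The processes $(S_t^{(x,j)})_{t\ge 0}$, $x\in\mathbb{Z}$, $j\in\mathbb{N}$, are i.i.d. simple symmetric continuous-time random walks on $\mathbb{Z}$ started at $0$ (times between jumps are $\exp(1)$-distributed, jumps are $-1$ and $+1$ with probability $1/2$ each), independent of $\eta$. At time $t=0$ there are $\eta(x)$ particles at each $x\in\mathbb{Z}$. The particles at the origin are active, all others are sleeping; if $\eta(0)=0$, one active particle is added at the origin at time $0$. Active particles perform independent simple symmetric continuous-time random walks. Sleeping particles stay still until the first arrival of an active particle to their location; upon arrival they become active and start their own walks. The position of the $j$-th particle started at $x$, $t$ units of time after the particles at $x$ were activated, is $x+S_t^{(x,j)}$. Let $\mathcal{A}_t$ be the set of sites visited by active particles by time $t$. The system explodes (an explosion occurs) if there exists $t\in(0,\infty)$ such that $\mathcal{A}_t$ is infinite. *)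

theory Defs
  imports "HOL-Probability.Probability"
begin

section \<open>Walks\<close>

text \<open>The walk with holding times \<open>h 0, h 1, \<dots>\<close> and jumps \<open>d 0, d 1, \<dots>\<close>, started at \<open>0\<close>:
  the \<open>n\<close>-th jump takes place at time \<open>h 0 + \<dots> + h (n - 1)\<close>. If infinitely many jumps
  take place by time \<open>t\<close> (an event of probability zero for exponential holding times),
  then \<open>card\<close> makes \<open>jumps_by h t\<close> equal to \<open>0\<close>.\<close>

definition jumps_by :: "(nat \<Rightarrow> real) \<Rightarrow> real \<Rightarrow> nat" where
  "jumps_by h t = card {n. 1 \<le> n \<and> (\<Sum>k<n. h k) \<le> t}"

definition walk :: "(nat \<Rightarrow> real) \<Rightarrow> (nat \<Rightarrow> int) \<Rightarrow> real \<Rightarrow> int" where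
  "walk h d t = (\<Sum>k<jumps_by h t. d k)"


section \<open>Dynamics for a fixed realisation\<close>

text \<open>In this section, \<open>c x\<close> is the number of particles placed at \<open>x\<close>, numbered
  \<open>0, \<dots>, c x - 1\<close>, and \<open>x + S x j u\<close> is the position of particle \<open>j\<close> of site \<open>x\<close>,
  \<open>u\<close> units of time after the particles at \<open>x\<close> were activated.

  \<open>reached c S y t\<close>: some finite chain of particles, the first one started at the origin at
  time \<open>0\<close> and each further one started from its site when the preceding one is there, is at
  \<open>y\<close> at time \<open>t\<close>. A chain need not start particles at the first possible moment,
  but this only delays it, so the infimum over all chains is the time of the first arrival.
  Finiteness of the chains means that activation always originates from the origin; arrivals
  \<open>from infinity\<close>, which could occur only after an explosion, are not counted.\<close>

inductive reached :: "(int \<Rightarrow> nat) \<Rightarrow> (int \<Rightarrow> nat \<Rightarrow> real \<Rightarrow> int) \<Rightarrow> int \<Rightarrow> real \<Rightarrow> bool"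
  for c :: "int \<Rightarrow> nat" and S :: "int \<Rightarrow> nat \<Rightarrow> real \<Rightarrow> int"
where
  origin: "reached c S 0 0"
| step: "\<lbrakk>reached c S x s; j < c x; 0 \<le> u; x + S x j u = y\<rbrakk> \<Longrightarrow> reached c S y (s + u)"

definition activation_time ::
  "(int \<Rightarrow> nat) \<Rightarrow> (int \<Rightarrow> nat \<Rightarrow> real \<Rightarrow> int) \<Rightarrow> int \<Rightarrow> ereal" where
  "activation_time c S y = Inf {ereal t |t. reached c S y t}"

definition visited ::
  "(int \<Rightarrow> nat) \<Rightarrow> (int \<Rightarrow> nat \<Rightarrow> real \<Rightarrow> int) \<Rightarrow> real \<Rightarrow> int set" where
  "visited c S t =
    {x + S x j u |x j u. j < c x \<and> 0 \<le> u \<and> activation_time c S x + ereal u \<le> ereal t}"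

definition explodes :: "(int \<Rightarrow> nat) \<Rightarrow> (int \<Rightarrow> nat \<Rightarrow> real \<Rightarrow> int) \<Rightarrow> bool" where
  "explodes c S \<longleftrightarrow> (\<exists>t>0. infinite (visited c S t))"

text \<open>The particle added at the origin if there is none.\<close>

definition with_origin :: "(int \<Rightarrow> nat) \<Rightarrow> int \<Rightarrow> nat" where
  "with_origin e x = (if x = 0 \<and> e 0 = 0 then 1 else e x)"


section \<open>The random frog model\<close>

text \<open>\<open>\<eta> x\<close> is the initial number of particles at \<open>x\<close>; \<open>\<tau> x j k\<close> and \<open>\<xi> x j k\<close> are
  the \<open>k\<close>-th holding time and the \<open>k\<close>-th jump of particle \<open>j\<close> of site \<open>x\<close>. The pairs
  (holding time, jump) are i.i.d. with independent components; this makes the walks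
  \<open>walk (\<tau> x j) (\<xi> x j)\<close> i.i.d. simple symmetric continuous-time random walks.
  Independence of \<open>\<eta>\<close> and the walks is stated with the generated
  sigma-algebras since \<^const>\<open>prob_space.indep_var\<close> needs variables of the same type.\<close>

locale frog_model = prob_space M
  for M :: "'w measure" +
  fixes \<mu> :: "nat pmf"
    and \<eta> :: "int \<Rightarrow> 'w \<Rightarrow> nat"
    and \<tau> :: "int \<Rightarrow> nat \<Rightarrow> nat \<Rightarrow> 'w \<Rightarrow> real"
    and \<xi> :: "int \<Rightarrow> nat \<Rightarrow> nat \<Rightarrow> 'w \<Rightarrow> int"
  assumes indep_initial: "indep_vars (\<lambda>_. count_space UNIV) \<eta> UNIV"
    and distr_initial: "\<And>x. distr M (count_space UNIV) (\<eta> x) = measure_pmf \<mu>"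
    and indep_steps:
      "indep_vars (\<lambda>_. borel \<Otimes>\<^sub>M count_space UNIV)
         (\<lambda>(x, j, k) \<omega>. (\<tau> x j k \<omega>, \<xi> x j k \<omega>)) UNIV"
    and distr_steps:
      "\<And>x j k. distr M (borel \<Otimes>\<^sub>M count_space UNIV) (\<lambda>\<omega>. (\<tau> x j k \<omega>, \<xi> x j k \<omega>)) =
         density lborel (exponential_density 1) \<Otimes>\<^sub>M measure_pmf (pmf_of_set {-1, 1})"
    and indep_initial_steps:
      "indep_set
         (sets (vimage_algebra (space M) (\<lambda>\<omega> x. \<eta> x \<omega>) (\<Pi>\<^sub>M x\<in>UNIV. count_space UNIV)))
         (sets (vimage_algebra (space M) (\<lambda>\<omega> (x, j, k). (\<tau> x j k \<omega>, \<xi> x j k \<omega>))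
           (\<Pi>\<^sub>M i\<in>UNIV. borel \<Otimes>\<^sub>M count_space UNIV)))"

definition explosion ::
  "(int \<Rightarrow> 'w \<Rightarrow> nat) \<Rightarrow> (int \<Rightarrow> nat \<Rightarrow> nat \<Rightarrow> 'w \<Rightarrow> real) \<Rightarrow>
   (int \<Rightarrow> nat \<Rightarrow> nat \<Rightarrow> 'w \<Rightarrow> int) \<Rightarrow> 'w \<Rightarrow> bool" where
  "explosion \<eta> \<tau> \<xi> \<omega> \<longleftrightarrow>
     explodes (with_origin (\<lambda>x. \<eta> x \<omega>))
       (\<lambda>x j. walk (\<lambda>k. \<tau> x j k \<omega>) (\<lambda>k. \<xi> x j k \<omega>))"


section \<open>The sequence of thresholds\<close>

definition recip_sum :: "(nat \<Rightarrow> real) \<Rightarrow> nat \<Rightarrow> real" where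
  "recip_sum A i = (\<Sum>z=1..i. 1 / A z)"

definition threshold :: "(nat \<Rightarrow> real) \<Rightarrow> nat \<Rightarrow> real" where
  "threshold A i = (if i = 0 then 0 else fact i / recip_sum A i ^ i)"

end

theory Submission
  imports Defs "HOL-Real_Asymp.Real_Asymp"
begin

text \<open>
  No explosion. A particle at distance \<open>i\<close> from a site needs at least \<open>i\<close> jumps to get
  there, and the probability of \<open>i\<close> jumps within time \<open>T\<close> is at most
  \<open>T ^ i / fact i\<close> (\<open>prob_many_jumps\<close>). If only \<open>threshold A i\<close> particles sit at distance \<open>i\<close>,
  the expected number of those that manage is at most \<open>(T / recip_sum A i) ^ i\<close>, which is summable
  because \<open>recip_sum A\<close> diverges. So even if every particle of the line is awake from
  the beginning, a given site is, with a probability bounded below, a barrier that no particle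
  crosses from the left before time \<open>T\<close>. Barriers that are far apart are almost
  independent, so there is almost surely one on each side of the origin
  (\<open>exists_good_centre\<close>, applied to the line and to its reflection in \<open>exists_quiet_centre\<close>),
  and the active particles are confined between them (\<open>finite_visited_if_confined\<close>).

  Explosion. By Borel--Cantelli, for every large \<open>m\<close> there is a distance \<open>1 \<le> i \<le> m\<close> such
  that the site \<open>m - i\<close> holds more than \<open>A m powr (\<rho> * i)\<close> particles. Each of them walks
  straight to \<open>m\<close> with all holding times at most \<open>1 / A m\<close> with probability at least
  \<open>(1 / (4 * A m)) ^ i\<close>; the surplus factor \<open>A m powr ((\<rho> - 1) * i)\<close> makes the probability that
  none does so summable in \<open>m\<close>, since \<open>A\<close> grows at least linearly. Hence \<open>m\<close> is reached
  at most \<open>i / A m\<close> later than \<open>m - i\<close>, and by monotonicity this is at most the part of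
  \<open>\<Sum>1 / A z\<close> between \<open>m - i\<close> and \<open>m\<close>. The delays telescope into the
  convergent series, so all positive sites are reached before one finite time
  (\<open>explodes_if_quick_crossings\<close>). The finitely many sites at which the descent from
  \<open>m\<close> to \<open>m - i\<close> can end are reached because the first particle is recurrent
  (\<open>simple_walk_hits_all\<close>).
\<close>

section \<open>Walks and chains of particles\<close>


lemma walk_at_jump_time:
  assumes "\<And>k. 0 < h k"
  shows "walk h d (\<Sum>k<n. h k) = (\<Sum>k<n. d k)"
proof -
  have mono: "(\<Sum>k<a. h k) \<le> (\<Sum>k<b. h k) \<longleftrightarrow> a \<le> b" for a b
  proof -
    have "strict_mono (\<lambda>a. \<Sum>k<a. h k)"
      by (rule strict_monoI_Suc) (use assms in simp)
    then show ?thesis using strict_mono_less_eq[where f="\<lambda>a. \<Sum>k<a. h k"] by blast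
  qed
  have "{m. 1 \<le> m \<and> (\<Sum>k<m. h k) \<le> (\<Sum>k<n. h k)} = {1..n}"
    by (auto simp: mono)
  then show ?thesis by (simp add: walk_def jumps_by_def)
qed

text \<open>A walk that has made fewer than \<open>i\<close> jumps has moved by less than \<open>i\<close>. Ignoring the directions
  of the jumps is affordable: it loses only the factor \<open>2 ^ i\<close>, which disappears in the freedom
  to choose the time horizon.\<close>

lemma abs_walk_less:
  assumes h: "\<And>k. 0 < h k" and d: "\<And>k. \<bar>d k\<bar> \<le> 1"
    and i: "1 \<le> i" and u: "u \<le> T" and T: "T < (\<Sum>k<i. h k)"
  shows "\<bar>walk h d u\<bar> < int i"
proof -
  have "m < i" if "(\<Sum>k<m. h k) \<le> u" for m
  proof (rule ccontr)
    assume "\<not> m < i"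
    then have "(\<Sum>k<i. h k) \<le> (\<Sum>k<m. h k)"
      by (intro sum_mono2) (auto intro: less_imp_le[OF h])
    then show False using that u T by simp
  qed
  then have "{m. 1 \<le> m \<and> (\<Sum>k<m. h k) \<le> u} \<subseteq> {1..<i}" by auto
  from card_mono[OF _ this] i have "jumps_by h u < i" by (simp add: jumps_by_def)
  moreover have "\<bar>walk h d u\<bar> \<le> (\<Sum>k<jumps_by h u. \<bar>d k\<bar>)"
    unfolding walk_def by (rule sum_abs)
  moreover have "\<dots> \<le> (\<Sum>k<jumps_by h u. 1)" by (rule sum_mono) (rule d)
  ultimately show ?thesis by simp
qed

lemma reached_nonneg: "reached c S y t \<Longrightarrow> 0 \<le> t"
  by (induction rule: reached.induct) auto

lemma explodes_if_reached:
  assumes c: "0 < c 0" and S: "S 0 0 0 = 0" and B: "0 < B"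
    and reach: "\<And>m::nat. \<exists>t\<le>B. reached c S (int m) t"
  shows "explodes c S"
proof -
  have "int m \<in> visited c S B" for m
  proof -
    obtain t where t: "t \<le> B" "reached c S (int m) t" using reach by blast
    from t(2) show ?thesis
    proof cases
      case origin
      have "activation_time c S 0 \<le> 0"
        unfolding activation_time_def by (rule Inf_lower) (auto intro!: exI[of _ 0] reached.origin simp: zero_ereal_def)
      then have "activation_time c S 0 + ereal 0 \<le> ereal B"
        using B by (simp add: order.trans[of _ 0])
      then show ?thesis
        unfolding visited_def using c S origin by force
    next
      case (step x s j u)
      have "activation_time c S x \<le> ereal s"
        unfolding activation_time_def by (rule Inf_lower) (use step in auto)
      then have "activation_time c S x + ereal u \<le> ereal s + ereal u"
        by (rule add_right_mono)
      also have "\<dots> \<le> ereal B" using t step by simp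
      finally show ?thesis unfolding visited_def using step by force
    qed
  qed
  then have "range int \<subseteq> visited c S B" by auto
  then have "infinite (visited c S B)"
    by (rule infinite_super) (simp add: range_inj_infinite inj_on_def)
  then show ?thesis unfolding explodes_def using B by blast
qed

text \<open>Activation spreads along finite chains that start at the origin, so a set
  which no particle starting in it can leave within time \<open>T\<close> confines all of them, even if each
  particle is given the whole time \<open>T\<close> from its own activation on. The gap between \<open>t\<close> and
  \<open>T\<close> is there because an activation time is an infimum that need not be attained by a chain.\<close>

lemma finite_visited_if_confined:
  assumes I: "finite I" "0 \<in> I" and t: "t < T"
    and conf: "\<And>x j u. x \<in> I \<Longrightarrow> j < c x \<Longrightarrow> 0 \<le> u \<Longrightarrow> u \<le> T \<Longrightarrow> x + S x j u \<in> I"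
  shows "finite (visited c S t)"
proof -
  have in_I: "y \<in> I" if "reached c S y s" "s \<le> T" for y s
    using that
  proof (induction rule: reached.induct)
    case origin
    show ?case by (rule I)
  next
    case (step x s j u y)
    then show ?case using conf[of x j u] reached_nonneg[OF step.hyps(1)] by auto
  qed
  have "visited c S t \<subseteq> I"
  proof
    fix y assume "y \<in> visited c S t"
    then obtain x j u where y: "y = x + S x j u" "j < c x" "0 \<le> u"
      and le: "activation_time c S x + ereal u \<le> ereal t"
      unfolding visited_def by blast
    have nonneg: "0 \<le> activation_time c S x"
      unfolding activation_time_def by (rule Inf_greatest) (auto dest: reached_nonneg)
    have act: "activation_time c S x \<le> ereal t"
      using le y(3) by (cases "activation_time c S x") auto
    have u: "u \<le> t" using le nonneg by (cases "activation_time c S x") auto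
    have "activation_time c S x < ereal T"
      using act t by (cases "activation_time c S x") auto
    then obtain s where "reached c S x s" "s < T"
      unfolding activation_time_def Inf_less_iff by auto
    then show "y \<in> I" using in_I[of x s] conf[of x j u] y u t by auto
  qed
  then show ?thesis using I(1) by (rule finite_subset)
qed

section \<open>Recurrence of the simple random walk\<close>


lemma measurable_int_sum:
  fixes X :: "'i \<Rightarrow> 'a \<Rightarrow> int"
  assumes X[measurable]: "\<And>i. i \<in> I \<Longrightarrow> X i \<in> measurable M (count_space UNIV)"
  shows "(\<lambda>\<omega>. \<Sum>i\<in>I. X i \<omega>) \<in> measurable M (count_space UNIV)"
  using X
proof (induction I rule: infinite_finite_induct)
  case (insert i I)
  have [measurable]: "X i \<in> measurable M (count_space UNIV)"
    "(\<lambda>\<omega>. \<Sum>i\<in>I. X i \<omega>) \<in> measurable M (count_space UNIV)"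
    using insert by auto
  have "(\<lambda>\<omega>. X i \<omega> + b) \<in> measurable M (count_space UNIV)" for b
    by measurable
  then have "(\<lambda>\<omega>. X i \<omega> + (\<Sum>i\<in>I. X i \<omega>)) \<in> measurable M (count_space UNIV)"
    by (rule measurable_compose_countable) measurable
  then show ?case using insert by simp
qed auto

lemma (in prob_space) indep_vars_reindex:
  assumes X: "indep_vars N X I" and f: "inj_on f J" "f ` J \<subseteq> I"
  shows "indep_vars (\<lambda>j. N (f j)) (\<lambda>j. X (f j)) J"
proof -
  have "indep_vars (\<lambda>j. PiM {f j} N) (\<lambda>j \<omega>. restrict (\<lambda>i. X i \<omega>) {f j}) J"
    using f by (intro indep_vars_restrict[OF X]) (auto simp: disjoint_family_on_def inj_on_def)
  then have "indep_vars (\<lambda>j. N (f j)) (\<lambda>j \<omega>. (restrict (\<lambda>i. X i \<omega>) {f j}) (f j)) J"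
    by (rule indep_vars_compose2) (auto intro: measurable_component_singleton)
  then show ?thesis by simp
qed

text \<open>The probability that a simple random walk started at \<open>0\<close> hits \<open>m\<close> within \<open>N\<close> steps,
  computed by conditioning on the first step.\<close>

fun hit_prob :: "nat \<Rightarrow> int \<Rightarrow> real" where
  "hit_prob 0 m = (if m = 0 then 1 else 0)"
| "hit_prob (Suc N) m =
    (if m = 0 then 1 else (hit_prob N (m - 1) + hit_prob N (m + 1)) / 2)"

text \<open>The starting index \<open>s\<close> is arbitrary because the first step hands over to the same
  question for the walk driven by the steps from \<open>Suc s\<close> on.\<close>

lemma (in prob_space) hit_prob_simple_walk:
  fixes X :: "nat \<Rightarrow> 'a \<Rightarrow> int"
  assumes indep: "indep_vars (\<lambda>_. count_space UNIV) X UNIV"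
    and up: "\<And>k. prob {\<omega> \<in> space M. X k \<omega> = 1} = 1/2"
    and down: "\<And>k. prob {\<omega> \<in> space M. X k \<omega> = -1} = 1/2"
  shows "prob {\<omega> \<in> space M. \<exists>n\<le>N. (\<Sum>k=s..<s+n. X k \<omega>) = m} = hit_prob N m"
proof (induction N arbitrary: s m)
  case 0
  then show ?case by (auto simp: prob_space)
next
  case (Suc N)
  have X[measurable]: "X k \<in> measurable M (count_space UNIV)" for k
    using indep unfolding indep_vars_def by auto
  have sum[measurable]: "(\<lambda>\<omega>. \<Sum>k=s..<s+n. X k \<omega>) \<in> measurable M (count_space UNIV)" for s n
    by (intro measurable_int_sum X)
  have ex_sum: "{\<omega> \<in> space M. \<exists>n\<le>N. (\<Sum>k=s..<s+n. X k \<omega>) = m} \<in> events" for N s m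
    by measurable
  define H where "H s m = {\<omega> \<in> space M. \<exists>n\<le>N. (\<Sum>k=s..<s+n. X k \<omega>) = m}" for s m
  have H[measurable]: "H s m \<in> events" for s m unfolding H_def by (rule ex_sum)
  show ?case
  proof (cases "m = 0")
    case True
    then have "{\<omega> \<in> space M. \<exists>n\<le>Suc N. (\<Sum>k=s..<s+n. X k \<omega>) = m} = space M"
      by (auto intro!: exI[of _ 0])
    then show ?thesis using True by (simp add: prob_space)
  next
    case False
    have split: "(\<Sum>k=s..<s+Suc n. X k \<omega>) = X s \<omega> + (\<Sum>k=Suc s..<Suc s+n. X k \<omega>)" for \<omega> n
      by (subst sum.atLeast_Suc_lessThan) auto
    have first: "(\<exists>n\<le>Suc N. (\<Sum>k=s..<s+n. X k \<omega>) = m) \<longleftrightarrow>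
        (\<exists>n\<le>N. X s \<omega> + (\<Sum>k=Suc s..<Suc s+n. X k \<omega>) = m)" for \<omega>
    proof
      assume "\<exists>n\<le>Suc N. (\<Sum>k=s..<s+n. X k \<omega>) = m"
      then obtain n where n: "n \<le> Suc N" "(\<Sum>k=s..<s+n. X k \<omega>) = m" by blast
      with False obtain n' where "n = Suc n'" by (cases n) auto
      then show "\<exists>n\<le>N. X s \<omega> + (\<Sum>k=Suc s..<Suc s+n. X k \<omega>) = m"
        using n unfolding \<open>n = Suc n'\<close> split by (intro exI[of _ n']) simp_all
    next
      assume "\<exists>n\<le>N. X s \<omega> + (\<Sum>k=Suc s..<Suc s+n. X k \<omega>) = m"
      then obtain n where n: "n \<le> N" "X s \<omega> + (\<Sum>k=Suc s..<Suc s+n. X k \<omega>) = m" by blast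
      then show "\<exists>n\<le>Suc N. (\<Sum>k=s..<s+n. X k \<omega>) = m"
        by (intro exI[of _ "Suc n"]) (simp_all only: split Suc_le_mono)
    qed
    \<comment> \<open>the first step is independent of all later ones\<close>
    have ind: "prob ({\<omega> \<in> space M. X s \<omega> = a} \<inter> H (Suc s) m') =
        prob {\<omega> \<in> space M. X s \<omega> = a} * prob (H (Suc s) m')" for a m'
    proof -
      let ?N = "\<lambda>_::nat. count_space (UNIV::int set)"
      have "indep_var (PiM {s} ?N) (\<lambda>\<omega>. restrict (\<lambda>i. X i \<omega>) {s})
          (PiM {Suc s..} ?N)
            (\<lambda>\<omega>. restrict (\<lambda>i. X i \<omega>) {Suc s..})"
        by (rule indep_var_restrict[OF indep]) auto
      moreover have "{f \<in> space (PiM {s} ?N). f s = a} \<in> sets (PiM {s} ?N)"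
        by measurable
      moreover have "{f \<in> space (PiM {Suc s..} ?N). \<exists>n\<le>N. (\<Sum>k=Suc s..<Suc s+n. f k) = m'}
          \<in> sets (PiM {Suc s..} ?N)"
      proof -
        have "(\<lambda>f. \<Sum>k=Suc s..<Suc s+n. f k) \<in> measurable (PiM {Suc s..} ?N) (count_space UNIV)" for n
          by (intro measurable_int_sum measurable_component_singleton) auto
        then show ?thesis by measurable
      qed
      ultimately have "prob ((\<lambda>\<omega>. (restrict (\<lambda>i. X i \<omega>) {s}, restrict (\<lambda>i. X i \<omega>) {Suc s..})) -`
          ({f \<in> space (PiM {s} ?N). f s = a} \<times> {f \<in> space (PiM {Suc s..} ?N). \<exists>n\<le>N. (\<Sum>k=Suc s..<Suc s+n. f k) = m'}) \<inter> space M) =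
        prob ((\<lambda>\<omega>. restrict (\<lambda>i. X i \<omega>) {s}) -` {f \<in> space (PiM {s} ?N). f s = a} \<inter> space M) *
        prob ((\<lambda>\<omega>. restrict (\<lambda>i. X i \<omega>) {Suc s..}) -` {f \<in> space (PiM {Suc s..} ?N). \<exists>n\<le>N. (\<Sum>k=Suc s..<Suc s+n. f k) = m'} \<inter> space M)"
        by (rule indep_varD)
      moreover have "(\<lambda>\<omega>. restrict (\<lambda>i. X i \<omega>) {s}) -` {f \<in> space (PiM {s} ?N). f s = a} \<inter> space M = {\<omega> \<in> space M. X s \<omega> = a}"
        by (auto simp: space_PiM)
      moreover have "(\<lambda>\<omega>. restrict (\<lambda>i. X i \<omega>) {Suc s..}) -` {f \<in> space (PiM {Suc s..} ?N). \<exists>n\<le>N. (\<Sum>k=Suc s..<Suc s+n. f k) = m'} \<inter> space M = H (Suc s) m'"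
        by (auto simp: space_PiM H_def simp del: sum.op_ivl_Suc)
      moreover have "(\<lambda>\<omega>. (restrict (\<lambda>i. X i \<omega>) {s}, restrict (\<lambda>i. X i \<omega>) {Suc s..})) -`
          ({f \<in> space (PiM {s} ?N). f s = a} \<times> {f \<in> space (PiM {Suc s..} ?N). \<exists>n\<le>N. (\<Sum>k=Suc s..<Suc s+n. f k) = m'}) \<inter> space M
         = {\<omega> \<in> space M. X s \<omega> = a} \<inter> H (Suc s) m'"
        by (auto simp: space_PiM H_def simp del: sum.op_ivl_Suc)
      ultimately show ?thesis by simp
    qed
    have "prob ({\<omega> \<in> space M. X s \<omega> = 1} \<union> {\<omega> \<in> space M. X s \<omega> = -1}) = 1"
      by (subst finite_measure_Union) (auto simp: up down)
    then have AE: "AE \<omega> in M. X s \<omega> = 1 \<or> X s \<omega> = -1"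
      by (subst (asm) prob_eq_1) auto
    have "prob {\<omega> \<in> space M. \<exists>n\<le>Suc N. (\<Sum>k=s..<s+n. X k \<omega>) = m} =
      prob ({\<omega> \<in> space M. X s \<omega> = 1} \<inter> H (Suc s) (m - 1) \<union> {\<omega> \<in> space M. X s \<omega> = -1} \<inter> H (Suc s) (m + 1))"
    proof (rule finite_measure_eq_AE)
      show "AE x in M. (x \<in> {\<omega> \<in> space M. \<exists>n\<le>Suc N. (\<Sum>k=s..<s+n. X k \<omega>) = m}) =
         (x \<in> {\<omega> \<in> space M. X s \<omega> = 1} \<inter> H (Suc s) (m - 1) \<union> {\<omega> \<in> space M. X s \<omega> = -1} \<inter> H (Suc s) (m + 1))"
        using AE
      proof eventually_elim
        case (elim \<omega>)
        have "X s \<omega> + a = m \<longleftrightarrow> X s \<omega> = 1 \<and> a = m - 1 \<or> X s \<omega> = -1 \<and> a = m + 1" for a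
          using elim by auto
        then show ?case by (simp only: mem_Collect_eq Un_iff Int_iff H_def first) blast
      qed
    next
      show "{\<omega> \<in> space M. \<exists>n\<le>Suc N. (\<Sum>k=s..<s+n. X k \<omega>) = m} \<in> events" by (rule ex_sum)
    qed measurable
    also have "\<dots> = prob ({\<omega> \<in> space M. X s \<omega> = 1} \<inter> H (Suc s) (m - 1)) + prob ({\<omega> \<in> space M. X s \<omega> = -1} \<inter> H (Suc s) (m + 1))"
      by (rule finite_measure_Union) auto
    also have "\<dots> = (hit_prob N (m - 1) + hit_prob N (m + 1)) / 2"
      unfolding ind up down using Suc.IH[of "Suc s"] unfolding H_def by simp
    finally show ?thesis using False by simp
  qed
qed

text \<open>A harmonic function on the half-line is affine, so it can be bounded only if it is constant.\<close>

lemma bounded_harmonic_eq_1: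
  fixes l :: "nat \<Rightarrow> real"
  assumes l0: "l 0 = 1" and harm: "\<And>m. l (Suc m) = (l m + l (Suc (Suc m))) / 2"
    and bound: "\<And>m. 0 \<le> l m" "\<And>m. l m \<le> 1"
  shows "l m = 1"
proof -
  have lin: "l m = 1 - m * (1 - l 1) \<and> l (Suc m) = 1 - (m + 1) * (1 - l 1)" for m
  proof (induction m)
    case (Suc m)
    have "l (Suc (Suc m)) = 2 * l (Suc m) - l m" using harm[of m] by simp
    also have "\<dots> = 1 - (Suc m + 1) * (1 - l 1)" using Suc by (simp add: algebra_simps)
    finally show ?case using Suc by (simp add: algebra_simps)
  qed (simp add: l0)
  have "l 1 = 1"
  proof (rule ccontr)
    assume "l 1 \<noteq> 1"
    with bound(2)[of 1] have "0 < 1 - l 1" by simp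
    then obtain m :: nat where "1 < m * (1 - l 1)" using reals_Archimedean3 by blast
    then show False using lin[of m] bound(1)[of m] by simp
  qed
  then show ?thesis using lin[of m] by simp
qed

text \<open>The hitting probability of \<open>m\<close>, as a function of \<open>m\<close>, is harmonic away from \<open>0\<close>,
  bounded, and equal to \<open>1\<close> at \<open>0\<close>; hence it is \<open>1\<close> on the half-line.\<close>

lemma (in prob_space) simple_walk_hits_all:
  fixes X :: "nat \<Rightarrow> 'a \<Rightarrow> int"
  assumes indep: "indep_vars (\<lambda>_. count_space UNIV) X UNIV"
    and up: "\<And>k. prob {\<omega> \<in> space M. X k \<omega> = 1} = 1/2"
    and down: "\<And>k. prob {\<omega> \<in> space M. X k \<omega> = -1} = 1/2"
  shows "AE \<omega> in M. \<forall>m::nat. \<exists>n. (\<Sum>k<n. X k \<omega>) = int m"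
proof -
  have X[measurable]: "X k \<in> measurable M (count_space UNIV)" for k
    using indep unfolding indep_vars_def by auto
  have sum[measurable]: "(\<lambda>\<omega>. \<Sum>k<n. X k \<omega>) \<in> measurable M (count_space UNIV)" for n
    by (intro measurable_int_sum X)
  define H where "H N m = {\<omega> \<in> space M. \<exists>n\<le>N. (\<Sum>k<n. X k \<omega>) = m}" for N m
  have H[measurable]: "H N m \<in> events" for N m unfolding H_def by measurable
  have prob_H: "prob (H N m) = hit_prob N m" for N m
    using hit_prob_simple_walk[OF assms, of N 0 m] by (simp add: H_def lessThan_atLeast0)
  define l where "l m = prob (\<Union>N. H N m)" for m
  have lim: "(\<lambda>N. hit_prob N m) \<longlonglongrightarrow> l m" for m
  proof -
    have "incseq (\<lambda>N. H N m)" unfolding H_def incseq_def by (auto intro: order_trans)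
    then show ?thesis
      unfolding l_def prob_H[symmetric] by (intro finite_Lim_measure_incseq) auto
  qed
  have harm: "l m = (l (m - 1) + l (m + 1)) / 2" if "m \<noteq> 0" for m
  proof -
    have "(\<lambda>N. hit_prob (Suc N) m) \<longlonglongrightarrow> (l (m - 1) + l (m + 1)) / 2"
      using that by (auto intro!: tendsto_intros lim)
    moreover have "(\<lambda>N. hit_prob (Suc N) m) \<longlonglongrightarrow> l m"
      using lim by (rule LIMSEQ_Suc)
    ultimately show ?thesis using LIMSEQ_unique by blast
  qed
  have "hit_prob N 0 = 1" for N by (cases N) auto
  then have l0: "l 0 = 1" using lim[of 0] by (simp add: LIMSEQ_const_iff)
  have "l (int m) = 1" for m
  proof (rule bounded_harmonic_eq_1[where l="\<lambda>m. l (int m)"])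
    show "l (int (Suc m)) = (l (int m) + l (int (Suc (Suc m)))) / 2" for m
      using harm[of "int (Suc m)"] by (simp add: algebra_simps)
  qed (simp add: l0, simp_all add: l_def)
  then have "AE \<omega> in M. \<omega> \<in> (\<Union>N. H N (int m))" for m :: nat
    unfolding l_def by (intro prob_eq_1[THEN iffD1]) auto
  then have "AE \<omega> in M. \<forall>m::nat. \<omega> \<in> (\<Union>N. H N (int m))"
    unfolding AE_all_countable by blast
  then show ?thesis
    by eventually_elim (auto simp: H_def)
qed

section \<open>Almost independent barriers\<close>


text \<open>The factors before some index are positive, and the rest of the product is at least
  one minus the tail of the sum of the defects.\<close>

lemma prod_bounded_below:
  fixes g :: "nat \<Rightarrow> real"
  assumes g: "\<And>i. 0 < g i" "\<And>i. g i \<le> 1" and sum: "summable (\<lambda>i. 1 - g i)"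
  shows "\<exists>p>0. \<forall>L. p \<le> (\<Prod>i<L. g i)"
proof -
  obtain n where n: "norm (\<Sum>i. 1 - g (i + n)) < 1/2"
    using suminf_exist_split[OF _ sum, of "1/2"] by auto
  have tail: "1/2 \<le> (\<Prod>i\<in>{n..<n+L}. g i)" for L
  proof -
    have "(\<Sum>i\<in>{n..<n+L}. 1 - g i) = (\<Sum>i<L. 1 - g (i + n))"
      using sum.shift_bounds_nat_ivl[of "\<lambda>i. 1 - g i" 0 n L] by (simp add: lessThan_atLeast0 add.commute)
    also have "\<dots> \<le> (\<Sum>i. 1 - g (i + n))"
      using g(2) summable_ignore_initial_segment[OF sum] by (intro sum_le_suminf) auto
    finally have "1/2 \<le> 1 - (\<Sum>i\<in>{n..<n+L}. 1 - g i)" using n by simp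
    also have "\<dots> \<le> (\<Prod>i\<in>{n..<n+L}. 1 - (1 - g i))"
      by (rule Weierstrass_prod_ineq) (use g in \<open>auto intro: less_imp_le\<close>)
    finally show ?thesis by simp
  qed
  have "(\<Prod>i<n. g i) / 2 \<le> (\<Prod>i<L. g i)" for L
  proof -
    have "(\<Prod>i<n. g i) / 2 \<le> (\<Prod>i<n. g i) * (\<Prod>i\<in>{n..<n+L}. g i)"
      using mult_left_mono[OF tail[of L], of "\<Prod>i<n. g i"] g(1)
      by (simp add: prod_nonneg less_imp_le)
    also have "\<dots> = (\<Prod>i<n+L. g i)"
      unfolding lessThan_atLeast0 by (rule prod.atLeastLessThan_concat) auto
    also have "\<dots> = (\<Prod>i<L. g i) * (\<Prod>i\<in>{L..<n+L}. g i)"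
      unfolding lessThan_atLeast0 by (rule prod.atLeastLessThan_concat[symmetric]) auto
    also have "\<dots> \<le> (\<Prod>i<L. g i)"
      using g by (intro mult_left_le prod_le_1 prod_nonneg) (auto intro: less_imp_le)
    finally show ?thesis .
  qed
  moreover have "(\<Prod>i<n. g i) / 2 > 0" using g by (simp add: prod_pos)
  ultimately show ?thesis by blast
qed

context prob_space
begin


lemma prob_finite_Inter:
  assumes "indep_events F UNIV" "finite J" "J \<noteq> {}"
  shows "prob (\<Inter>x\<in>J. F x) = (\<Prod>x\<in>J. prob (F x))"
  using assms unfolding indep_events_def by blast

lemma indep_events_reindex:
  assumes F: "indep_events F UNIV" and f: "inj f"
  shows "indep_events (\<lambda>i. F (f i)) UNIV"
proof (rule indep_eventsI)
  show "F (f i) \<in> events" for i using F by (auto simp: indep_events_def)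
  fix J :: "'c set" assume J: "finite J" "J \<noteq> {}"
  have "prob (\<Inter>x\<in>f ` J. F x) = (\<Prod>x\<in>f ` J. prob (F x))"
    using J by (intro prob_finite_Inter[OF F]) auto
  also have "\<dots> = (\<Prod>j\<in>J. prob (F (f j)))"
    using f by (simp add: prod.reindex inj_on_def inj_def)
  finally show "prob (\<Inter>j\<in>J. F (f j)) = (\<Prod>j\<in>J. prob (F (f j)))" by simp
qed

lemma indep_events_blocks:
  assumes F: "indep_events F UNIV" and B: "\<And>k. finite (B k)" "\<And>k. B k \<noteq> {}"
    and disj: "\<And>k l. k \<noteq> l \<Longrightarrow> B k \<inter> B l = {}"
  shows "indep_events (\<lambda>k. \<Inter>x\<in>B k. F x) UNIV"
proof (rule indep_eventsI)
  have [simp]: "F x \<in> events" for x using F by (auto simp: indep_events_def)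
  note prob_Inter = prob_finite_Inter[OF F]
  show "(\<Inter>x\<in>B k. F x) \<in> events" for k
    using B by (intro sets.finite_INT) auto
  fix J :: "'c set" assume J: "finite J" "J \<noteq> {}"
  have "(\<Inter>k\<in>J. \<Inter>x\<in>B k. F x) = (\<Inter>x\<in>(\<Union>k\<in>J. B k). F x)" by auto
  then have "prob (\<Inter>k\<in>J. \<Inter>x\<in>B k. F x) = (\<Prod>x\<in>(\<Union>k\<in>J. B k). prob (F x))"
    using J B by (simp only:) (rule prob_Inter, auto)
  also have "\<dots> = (\<Prod>k\<in>J. \<Prod>x\<in>B k. prob (F x))"
    using J B disj by (intro prod.UNION_disjoint) auto
  also have "\<dots> = (\<Prod>k\<in>J. prob (\<Inter>x\<in>B k. F x))"
    using B by (simp add: prob_Inter)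
  finally show "prob (\<Inter>k\<in>J. \<Inter>x\<in>B k. F x) = (\<Prod>k\<in>J. prob (\<Inter>x\<in>B k. F x))" .
qed

text \<open>By the zero-one law for independent events, it is enough to exclude that almost
  surely only finitely many of them occur; but the probability of infinitely many is at least the
  infimum of the single probabilities.\<close>

lemma AE_infinitely_often:
  fixes G :: "nat \<Rightarrow> 'a set"
  assumes G: "indep_events G UNIV" and p: "0 < p" "\<And>k. p \<le> prob (G k)"
  shows "AE \<omega> in M. infinite {k. \<omega> \<in> G k}"
proof -
  have [measurable]: "G k \<in> events" for k using G by (auto simp: indep_events_def)
  have "{\<omega> \<in> space M. \<omega> \<in> G k} = G k" for k
    using sets.sets_into_space[of "G k" M] by auto
  then have "(AE \<omega> in M. infinite {k. \<omega> \<in> G k}) \<or> (AE \<omega> in M. finite {k. \<omega> \<in> G k})"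
    using borel_0_1_law_AE[of "\<lambda>k \<omega>. \<omega> \<in> G k"] G by simp
  moreover have "\<not> (AE \<omega> in M. finite {k. \<omega> \<in> G k})"
  proof
    assume "AE \<omega> in M. finite {k. \<omega> \<in> G k}"
    then have "AE \<omega> in M. \<omega> \<notin> (\<Inter>n. \<Union>k\<in>{n..}. G k)"
    proof eventually_elim
      case (elim \<omega>)
      then obtain n where "\<And>k. \<omega> \<in> G k \<Longrightarrow> k < n"
        unfolding finite_nat_set_iff_bounded by blast
      then have "\<omega> \<notin> (\<Union>k\<in>{n..}. G k)" by fastforce
      then show ?case by blast
    qed
    then have "prob (\<Inter>n. \<Union>k\<in>{n..}. G k) = 0"
      by (subst prob_eq_0) auto
    moreover have "(\<lambda>n. prob (\<Union>k\<in>{n..}. G k)) \<longlonglongrightarrow> prob (\<Inter>n. \<Union>k\<in>{n..}. G k)"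
      by (rule finite_Lim_measure_decseq) (auto simp: decseq_def intro: order_trans)
    moreover have "p \<le> prob (\<Union>k\<in>{n..}. G k)" for n
      by (rule order_trans[OF p(2)[of n]], rule finite_measure_mono) auto
    ultimately have "p \<le> 0" using LIMSEQ_le_const[of _ 0 p] by fastforce
    then show False using p by simp
  qed
  ultimately show ?thesis by blast
qed

text \<open>Here \<open>Q i x\<close> stands for the event that the site \<open>x\<close> does no harm at distance \<open>i\<close>, and a centre
  \<open>m\<close> is good if no site at or to the left of \<open>m\<close> does harm at its distance from \<open>m\<close>. Goodness of a
  centre has positive probability but involves infinitely many sites, so that different centres
  are dependent. The line is therefore cut into disjoint blocks, with one centre at the right end
  of each of them. The part of goodness that concerns the block itself is independent
  for different blocks and holds infinitely often. The remaining sites do harm to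
  only finitely many of these centres, since the lengths of the blocks are chosen to make the
  probabilities summable.\<close>

lemma exists_good_centre:
  fixes Q :: "nat \<Rightarrow> int \<Rightarrow> 'a set"
  assumes indep: "\<And>d. indep_events (\<lambda>x. Q (d x) x) UNIV"
    and low: "\<And>i x. g i \<le> prob (Q i x)" and pos: "\<And>i. 0 < g i"
    and sum: "summable (\<lambda>i. 1 - g i)"
  shows "AE \<omega> in M. \<exists>m\<ge>0. \<forall>i. \<omega> \<in> Q i (m - int i)"
proof -
  have [measurable]: "Q i x \<in> events" for i x
    using indep[of "\<lambda>_. i"] by (auto simp: indep_events_def)
  have g1: "g i \<le> 1" for i using low[of i 0] prob_le_1[of "Q i 0"] by linarith
  obtain p where p: "0 < p" "\<And>L. p \<le> (\<Prod>i<L. g i)"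
    using prod_bounded_below[of g] pos g1 sum by auto
  \<comment> \<open>the length of the \<open>k\<close>-th block, as required by the sites outside of it\<close>
  have "\<exists>L. 1 \<le> L \<and> (\<Sum>i. 1 - g (i + L)) \<le> (1/2) ^ k" for k :: nat
  proof -
    obtain N where "\<And>n. N \<le> n \<Longrightarrow> norm (\<Sum>i. 1 - g (i + n)) < (1/2) ^ k"
      using suminf_exist_split[OF _ sum, of "(1/2) ^ k"] by auto
    from this[of "Suc N"] show ?thesis by (intro exI[of _ "Suc N"]) auto
  qed
  then obtain L where L: "\<And>k::nat. 1 \<le> L k" "\<And>k. (\<Sum>i. 1 - g (i + L k)) \<le> (1/2) ^ k"
    by metis
  define e where "e k = int (\<Sum>j<k. L j)" for k
  have e_Suc: "e (Suc k) = e k + int (L k)" for k by (simp add: e_def)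
  have e_mono: "e k \<le> e l" if "k \<le> l" for k l
    unfolding e_def using that by (auto intro!: sum_mono2)
  have e_nonneg: "0 \<le> e k" for k by (simp add: e_def sum_nonneg)
  \<comment> \<open>the \<open>k\<close>-th block; its centre is its last site \<open>e (Suc k) - 1\<close>\<close>
  define B where "B k = {e k ..< e (Suc k)}" for k
  have less_if: "k \<le> l" if "x \<in> B k" "x < e (Suc l)" for k l x
    using that e_mono[of "Suc l" k] by (cases "k \<le> l") (auto simp: B_def)
  define blk where "blk x = (LEAST k. x < e (Suc k))" for x
  have blk: "blk x = k" if "x \<in> B k" for x k
    unfolding blk_def using that less_if by (intro Least_equality) (auto simp: B_def)
  \<comment> \<open>the distance of a site from the centre of its own block\<close>
  define d where "d x = nat (e (Suc (blk x)) - 1 - x)" for x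
  have B_image: "B k = (\<lambda>i. e (Suc k) - 1 - int i) ` {..<L k}" for k
  proof (intro set_eqI iffI)
    fix x assume "x \<in> B k"
    then show "x \<in> (\<lambda>i. e (Suc k) - 1 - int i) ` {..<L k}"
      by (intro image_eqI[of _ _ "nat (e (Suc k) - 1 - x)"]) (auto simp: B_def e_Suc)
  qed (auto simp: B_def e_Suc)
  have B_fin: "finite (B k)" for k by (simp add: B_def)
  have B_ne: "B k \<noteq> {}" for k using L(1)[of k] by (simp add: B_image lessThan_empty_iff)
  have d: "d (e (Suc k) - 1 - int i) = i" if "i < L k" for k i
    using blk[of "e (Suc k) - 1 - int i" k] that unfolding B_image by (auto simp: d_def)
  define G where "G k = (\<Inter>x\<in>B k. Q (d x) x)" for k
  have G_eq: "G k = (\<Inter>i<L k. Q i (e (Suc k) - 1 - int i))" for k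
    unfolding G_def B_image using d by auto
  have G: "indep_events G UNIV"
    unfolding G_def
  proof (rule indep_events_blocks[OF indep])
    show "B k \<inter> B l = {}" if "k \<noteq> l" for k l using blk that by blast
  qed (rule B_fin B_ne)+
  have "p \<le> prob (G k)" for k
  proof -
    have "p \<le> (\<Prod>i<L k. g i)" by (rule p)
    also have "\<dots> \<le> (\<Prod>i<L k. prob (Q i (e (Suc k) - 1 - int i)))"
      using low pos by (intro prod_mono) (auto intro: less_imp_le)
    also have "\<dots> = (\<Prod>i<L k. prob (Q (d (e (Suc k) - 1 - int i)) (e (Suc k) - 1 - int i)))"
      using d by simp
    also have "\<dots> = (\<Prod>x\<in>B k. prob (Q (d x) x))"
      unfolding B_image by (subst prod.reindex) (auto simp: inj_on_def)
    also have "\<dots> = prob (G k)"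
      using indep[of d] B_fin B_ne unfolding G_def indep_events_def by simp
    finally show ?thesis .
  qed
  then have inf: "AE \<omega> in M. infinite {k. \<omega> \<in> G k}"
    by (rule AE_infinitely_often[OF G p(1)])
  \<comment> \<open>some site to the left of the block does harm\<close>
  define R where "R k = (\<Union>i. space M - Q (i + L k) (e (Suc k) - 1 - int (i + L k)))" for k
  have R[measurable]: "R k \<in> events" for k unfolding R_def by measurable
  have "prob (R k) \<le> (1/2) ^ k" for k
  proof -
    have le: "prob (space M - Q i x) \<le> 1 - g i" for i x
      using low[of i x] by (simp add: prob_compl)
    have sums: "summable (\<lambda>i. 1 - g (i + L k))" by (rule summable_ignore_initial_segment[OF sum])
    have summ: "summable (\<lambda>i. prob (space M - Q (i + L k) (e (Suc k) - 1 - int (i + L k))))"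
      by (rule summable_comparison_test_ev[OF _ sums]) (use le in auto)
    have "prob (R k) \<le> (\<Sum>i. prob (space M - Q (i + L k) (e (Suc k) - 1 - int (i + L k))))"
      unfolding R_def by (rule finite_measure_subadditive_countably) (use summ in auto)
    also have "\<dots> \<le> (\<Sum>i. 1 - g (i + L k))"
      by (rule suminf_le[OF le summ sums])
    finally show ?thesis using L(2)[of k] by simp
  qed
  then have "summable (\<lambda>k. prob (R k))"
    by (intro summable_comparison_test_ev[OF _ summable_geometric[of "1/2"]]) auto
  then have "AE \<omega> in M. eventually (\<lambda>k. \<omega> \<in> space M - R k) sequentially"
    by (intro borel_cantelli_AE1) (auto simp: less_top[symmetric])
  then show ?thesis
    using inf
  proof eventually_elim
    case (elim \<omega>)
    then obtain N where N: "\<And>k. N \<le> k \<Longrightarrow> \<omega> \<in> space M - R k"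
      by (auto simp: eventually_sequentially)
    obtain k where k: "N \<le> k" "\<omega> \<in> G k"
      using elim(2) by (auto simp: infinite_nat_iff_unbounded_le)
    have "\<omega> \<in> Q i (e (Suc k) - 1 - int i)" for i
    proof (cases "i < L k")
      case True
      then show ?thesis using k unfolding G_eq by auto
    next
      case False
      then obtain j where j: "i = j + L k" using le_Suc_ex[of "L k" i] by (auto simp: add.commute)
      have "\<omega> \<in> Q (j + L k) (e (Suc k) - 1 - int (j + L k))"
        using N[OF k(1)] unfolding R_def by blast
      then show ?thesis unfolding j .
    qed
    moreover have "0 \<le> e (Suc k) - 1" using e_nonneg[of k] L(1)[of k] by (simp add: e_Suc)
    ultimately show ?case by blast
  qed
qed

end


section \<open>Single steps of the frog model\<close>


text \<open>The left-hand side is the probability that a Poisson process of rate \<open>1\<close> makes at least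
  \<open>i\<close> jumps by time \<open>T\<close>.\<close>

lemma exp_tail_le:
  fixes T :: real assumes "0 \<le> T"
  shows "1 - exp (-T) * (\<Sum>n<i. T ^ n / fact n) \<le> T ^ i / fact i"
proof -
  obtain t where t: "\<bar>t\<bar> \<le> \<bar>T\<bar>" "exp T = (\<Sum>n<i. T ^ n / fact n) + exp t / fact i * T ^ i"
    using Maclaurin_exp_le[of T i] by auto
  have "1 - exp (-T) * (\<Sum>n<i. T ^ n / fact n) = exp (-T) * (exp T - (\<Sum>n<i. T ^ n / fact n))"
    by (simp add: algebra_simps flip: exp_add)
  also have "\<dots> = exp (t - T) * (T ^ i / fact i)"
    unfolding t(2) by (simp add: exp_diff exp_minus field_simps)
  also have "\<dots> \<le> 1 * (T ^ i / fact i)"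
    using t assms by (intro mult_right_mono) auto
  finally show ?thesis by simp
qed

context frog_model
begin


lemma step_measurable: "(\<lambda>\<omega>. (\<tau> x j k \<omega>, \<xi> x j k \<omega>)) \<in> measurable M (borel \<Otimes>\<^sub>M count_space UNIV)"
  using indep_steps unfolding indep_vars_def by (auto dest!: bspec[of _ _ "(x, j, k)"])

lemma \<tau>_measurable[measurable]: "\<tau> x j k \<in> borel_measurable M"
  using measurable_compose[OF step_measurable measurable_fst] by simp

lemma \<xi>_measurable[measurable]: "\<xi> x j k \<in> measurable M (count_space UNIV)"
  using measurable_compose[OF step_measurable measurable_snd] by simp

lemma \<eta>_measurable[measurable]: "\<eta> x \<in> measurable M (count_space UNIV)"
  using indep_initial unfolding indep_vars_def by auto

lemma prob_initial: "prob {\<omega> \<in> space M. P (\<eta> x \<omega>)} = measure_pmf.prob \<mu> {n. P n}"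
  unfolding distr_initial[symmetric, of x]
  by (subst measure_distr) (auto intro!: arg_cong[where f=prob])

lemma prob_step:
  assumes [measurable]: "A \<in> sets borel"
  shows "prob {\<omega> \<in> space M. \<tau> x j k \<omega> \<in> A \<and> \<xi> x j k \<omega> \<in> B} =
    measure (density lborel (exponential_density 1)) A * measure_pmf.prob (pmf_of_set {-1, 1}) B"
proof -
  interpret E: prob_space "density lborel (exponential_density 1)"
    by (rule prob_space_exponential_density) simp
  have "prob {\<omega> \<in> space M. \<tau> x j k \<omega> \<in> A \<and> \<xi> x j k \<omega> \<in> B} =
      measure (distr M (borel \<Otimes>\<^sub>M count_space UNIV) (\<lambda>\<omega>. (\<tau> x j k \<omega>, \<xi> x j k \<omega>))) (A \<times> B)"
    by (subst measure_distr[OF step_measurable]) (auto intro!: arg_cong[where f=prob])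
  also have "\<dots> = measure (density lborel (exponential_density 1)) A * measure_pmf.prob (pmf_of_set {-1, 1}) B"
    unfolding distr_steps measure_def
    by (subst measure_pmf.emeasure_pair_measure_Times) (auto simp: enn2real_mult)
  finally show ?thesis .
qed

lemma prob_holding_time:
  assumes [measurable]: "A \<in> sets borel"
  shows "prob {\<omega> \<in> space M. \<tau> x j k \<omega> \<in> A} = measure (density lborel (exponential_density 1)) A"
  using prob_step[OF assms, of x j k UNIV] by simp

lemma prob_jump: "prob {\<omega> \<in> space M. \<xi> x j k \<omega> = a} = pmf (pmf_of_set {-1, 1}) a"
proof -
  interpret E: prob_space "density lborel (exponential_density 1)"
    by (rule prob_space_exponential_density) simp
  show ?thesis
    using prob_step[of UNIV x j k "{a}"] E.prob_space by (simp add: measure_pmf_single)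
qed

lemma holding_time_exponential: "distributed M lborel (\<tau> x j k) (exponential_density 1)"
proof -
  have "distr M borel (\<tau> x j k) = density lborel (exponential_density 1)"
  proof (rule measure_eqI)
    fix A assume "A \<in> sets (distr M borel (\<tau> x j k))"
    then have [measurable]: "A \<in> sets borel" by simp
    interpret E: prob_space "density lborel (exponential_density 1)"
      by (rule prob_space_exponential_density) simp
    show "emeasure (distr M borel (\<tau> x j k)) A = emeasure (density lborel (exponential_density 1)) A"
      using prob_holding_time[of A x j k]
      by (simp add: emeasure_distr emeasure_eq_measure E.emeasure_eq_measure vimage_def Int_def conj_commute)
  qed simp
  moreover have "distr M lborel (\<tau> x j k) = distr M borel (\<tau> x j k)"
    by (rule distr_cong) auto
  ultimately show ?thesis unfolding distributed_def by auto
qed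

lemma prob_holding_time_gt: "0 \<le> a \<Longrightarrow> prob {\<omega> \<in> space M. a < \<tau> x j k \<omega>} = exp (-a)"
  using exponential_distributedD_gt[OF holding_time_exponential, of a] by simp

lemma prob_quick_right_step:
  assumes "0 \<le> a"
  shows "prob {\<omega> \<in> space M. \<tau> x j k \<omega> \<le> a \<and> \<xi> x j k \<omega> = 1} = (1 - exp (-a)) / 2"
proof -
  have "measure (density lborel (exponential_density 1)) {..a} = 1 - exp (-a)"
    using exponential_distributedD_le[OF holding_time_exponential, of a] assms
      prob_holding_time[of "{..a}"] by simp
  then show ?thesis using prob_step[of "{..a}" x j k "{1}"] by (simp add: measure_pmf_single)
qed

lemma AE_regular_steps:
  "AE \<omega> in M. \<forall>x j k. 0 < \<tau> x j k \<omega> \<and> \<xi> x j k \<omega> \<in> {-1, 1}"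
proof -
  have "prob {\<omega> \<in> space M. \<tau> x j k \<omega> \<in> {0<..} \<and> \<xi> x j k \<omega> \<in> {-1, 1}} = 1" for x j k
    using prob_holding_time_gt[of 0 x j k] prob_holding_time[of "{0<..}" x j k]
      measure_pmf.prob_eq_1[of "{-1, 1}" "pmf_of_set {-1, 1::int}"]
    by (subst prob_step) (auto simp: AE_measure_pmf_iff)
  then have "AE \<omega> in M. 0 < \<tau> x j k \<omega> \<and> \<xi> x j k \<omega> \<in> {-1, 1}" for x j k
    by (subst (asm) prob_eq_1) auto
  then show ?thesis unfolding AE_all_countable by blast
qed

text \<open>The time of the \<open>i\<close>-th jump has an Erlang distribution.\<close>

lemma prob_many_jumps:
  assumes "0 \<le> T"
  shows "prob {\<omega> \<in> space M. (\<Sum>k<i. \<tau> x j k \<omega>) \<le> T} \<le> T ^ i / fact i"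
proof (cases "i = 0")
  case False
  have "indep_vars (\<lambda>k. borel \<Otimes>\<^sub>M count_space UNIV) (\<lambda>k \<omega>. (\<tau> x j k \<omega>, \<xi> x j k \<omega>)) {..<i}"
    using indep_vars_reindex[OF indep_steps, of "\<lambda>k. (x, j, k)" "{..<i}"] by (simp add: inj_on_def)
  then have indep: "indep_vars (\<lambda>k. borel) (\<tau> x j) {..<i}"
    using indep_vars_compose2[of _ _ _ "\<lambda>_. fst" "\<lambda>_. borel"] by force
  have "distributed M lborel (\<lambda>\<omega>. \<Sum>k<i. \<tau> x j k \<omega>) (erlang_density (card {..<i} - 1) 1)"
    using False by (intro exponential_distributed_sum indep holding_time_exponential) auto
  from erlang_distributed_le[OF this _ assms]
  have "prob {\<omega> \<in> space M. (\<Sum>k<i. \<tau> x j k \<omega>) \<le> T} = erlang_CDF (i - 1) 1 T" by simp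
  also have "\<dots> = 1 - exp (-T) * (\<Sum>n<i. T ^ n / fact n)"
    using False assms by (simp add: erlang_CDF_def sum_distrib_left mult.commute lessThan_Suc_atMost[symmetric])
  finally show ?thesis using exp_tail_le[OF assms] by simp
qed auto

lemma AE_origin_particle_hits:
  "AE \<omega> in M. \<forall>m::nat. \<exists>n. (\<Sum>k<n. \<xi> 0 0 k \<omega>) = int m"
proof (rule simple_walk_hits_all)
  have "indep_vars (\<lambda>k. borel \<Otimes>\<^sub>M count_space UNIV) (\<lambda>k \<omega>. (\<tau> 0 0 k \<omega>, \<xi> 0 0 k \<omega>)) UNIV"
    using indep_vars_reindex[OF indep_steps, of "\<lambda>k. (0, 0, k)" UNIV] by (simp add: inj_on_def)
  then show "indep_vars (\<lambda>_. count_space UNIV) (\<xi> 0 0) UNIV"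
    using indep_vars_compose2[of _ _ _ "\<lambda>_. snd" "\<lambda>_. count_space UNIV"] by force
qed (simp_all add: prob_jump)

section \<open>Absence of explosions\<close>


text \<open>The bound on the walks refers to the fixed number \<open>b\<close> and not to
  \<open>\<eta> x\<close>, so that the event is the intersection of one that depends on the initial
  configuration and one that depends on the walks. One walk more than \<open>b\<close> is included
  on account of the particle that may be added at the origin.\<close>

definition quiet :: "real \<Rightarrow> nat \<Rightarrow> nat \<Rightarrow> int \<Rightarrow> 'w set" where
  "quiet T b i x = {\<omega> \<in> space M. \<eta> x \<omega> \<le> b \<and> (\<forall>j\<le>b. T < (\<Sum>k<i. \<tau> x j k \<omega>))}"

text \<open>The events are independent in \<open>x\<close> separately for the initial configuration and for the
  walks, and these two are independent of each other.\<close>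

lemma prob_Inter_quiet:
  assumes J: "finite J" "J \<noteq> {}"
  shows "prob (\<Inter>x\<in>J. quiet T (b x) (i x) x) =
    (\<Prod>x\<in>J. prob {\<omega> \<in> space M. \<eta> x \<omega> \<le> b x} *
      prob {\<omega> \<in> space M. \<forall>j\<le>b x. T < (\<Sum>k<i x. \<tau> x j k \<omega>)})"
proof -
  define E where "E x = {\<omega> \<in> space M. \<eta> x \<omega> \<le> b x}" for x
  define W where "W x = {\<omega> \<in> space M. \<forall>j\<le>b x. T < (\<Sum>k<i x. \<tau> x j k \<omega>)}" for x
  let ?N = "\<lambda>_::int\<times>nat\<times>nat. (borel::real measure) \<Otimes>\<^sub>M count_space (UNIV::int set)"
  let ?X = "\<lambda>(x, j, k) \<omega>. (\<tau> x j k \<omega>, \<xi> x j k \<omega>)"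
  let ?C = "\<lambda>x::int. {x} \<times> (UNIV::nat set) \<times> (UNIV::nat set)"
  have E: "indep_events E UNIV"
    unfolding E_def by (rule indep_eventsI_indep_vars[OF indep_initial]) auto
  have "indep_vars (\<lambda>x. PiM (?C x) ?N) (\<lambda>x \<omega>. restrict (\<lambda>p. ?X p \<omega>) (?C x)) UNIV"
    by (rule indep_vars_restrict[OF indep_steps]) (auto simp: disjoint_family_on_def)
  then have "indep_events (\<lambda>x. {\<omega> \<in> space M.
      \<forall>j\<le>b x. T < (\<Sum>k<i x. fst (restrict (\<lambda>p. ?X p \<omega>) (?C x) (x, j, k)))}) UNIV"
    by (rule indep_eventsI_indep_vars) measurable
  then have W: "indep_events W UNIV" unfolding W_def by simp
  \<comment> \<open>both intersections belong to the sigma-algebras that are independent in the model\<close>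
  let ?PE = "PiM UNIV (\<lambda>_::int. count_space (UNIV::nat set))"
  let ?PW = "PiM UNIV ?N"
  have "{f \<in> space ?PE. \<forall>x\<in>J. f x \<le> b x} \<in> sets ?PE"
    using J by measurable
  from in_vimage_algebra[OF this, of "\<lambda>\<omega> x. \<eta> x \<omega>" "space M"]
  have "(\<lambda>\<omega> x. \<eta> x \<omega>) -` {f \<in> space ?PE. \<forall>x\<in>J. f x \<le> b x} \<inter> space M
      \<in> sets (vimage_algebra (space M) (\<lambda>\<omega> x. \<eta> x \<omega>) ?PE)" .
  moreover have "(\<lambda>\<omega> x. \<eta> x \<omega>) -` {f \<in> space ?PE. \<forall>x\<in>J. f x \<le> b x} \<inter> space M = (\<Inter>x\<in>J. E x)"
    using J by (auto simp: E_def space_PiM)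
  ultimately have setE: "(\<Inter>x\<in>J. E x) \<in> sets (vimage_algebra (space M) (\<lambda>\<omega> x. \<eta> x \<omega>) ?PE)"
    by simp
  have "{f \<in> space ?PW. \<forall>x\<in>J. \<forall>j\<le>b x. T < (\<Sum>k<i x. fst (f (x, j, k)))} \<in> sets ?PW"
    using J by measurable
  from in_vimage_algebra[OF this, of "\<lambda>\<omega> p. ?X p \<omega>" "space M"]
  have "(\<lambda>\<omega> p. ?X p \<omega>) -` {f \<in> space ?PW. \<forall>x\<in>J. \<forall>j\<le>b x. T < (\<Sum>k<i x. fst (f (x, j, k)))} \<inter> space M
      \<in> sets (vimage_algebra (space M) (\<lambda>\<omega> p. ?X p \<omega>) ?PW)" .
  moreover have "(\<lambda>\<omega> p. ?X p \<omega>) -` {f \<in> space ?PW. \<forall>x\<in>J. \<forall>j\<le>b x. T < (\<Sum>k<i x. fst (f (x, j, k)))} \<inter> space M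
      = (\<Inter>x\<in>J. W x)"
    using J by (auto simp: W_def space_PiM space_pair_measure)
  ultimately have setW: "(\<Inter>x\<in>J. W x) \<in> sets (vimage_algebra (space M) (\<lambda>\<omega> p. ?X p \<omega>) ?PW)"
    by simp
  have "(\<lambda>\<omega> p. ?X p \<omega>) = (\<lambda>\<omega> (x, j, k). (\<tau> x j k \<omega>, \<xi> x j k \<omega>))"
    by (auto simp: fun_eq_iff)
  then have "prob ((\<Inter>x\<in>J. E x) \<inter> (\<Inter>x\<in>J. W x)) = prob (\<Inter>x\<in>J. E x) * prob (\<Inter>x\<in>J. W x)"
    using indep_setD[OF indep_initial_steps setE] setW by simp
  moreover have "(\<Inter>x\<in>J. quiet T (b x) (i x) x) = (\<Inter>x\<in>J. E x) \<inter> (\<Inter>x\<in>J. W x)"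
    using J by (auto simp: quiet_def E_def W_def)
  ultimately show ?thesis
    using prob_finite_Inter[OF E J] prob_finite_Inter[OF W J] by (simp add: prod.distrib E_def W_def)
qed

lemma indep_quiet: "indep_events (\<lambda>x. quiet T (b x) (i x) x) UNIV"
proof (rule indep_eventsI)
  show "quiet T (b x) (i x) x \<in> events" for x unfolding quiet_def by measurable
  fix J :: "int set" assume J: "finite J" "J \<noteq> {}"
  show "prob (\<Inter>x\<in>J. quiet T (b x) (i x) x) = (\<Prod>x\<in>J. prob (quiet T (b x) (i x) x))"
    using prob_Inter_quiet[OF J] prob_Inter_quiet[of "{x}" T b i for x] by simp
qed

text \<open>A union bound over the particles. It is good at large distances \<open>i\<close>.\<close>

lemma prob_quiet_ge:
  assumes "0 \<le> T"
  shows "1 - (measure_pmf.prob \<mu> {n. b < n} + (real b + 1) * (T ^ i / fact i)) \<le> prob (quiet T b i x)"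
proof -
  let ?D = "\<lambda>j. {\<omega> \<in> space M. (\<Sum>k<i. \<tau> x j k \<omega>) \<le> T}"
  have [measurable]: "quiet T b i x \<in> events" unfolding quiet_def by measurable
  have "1 - prob (quiet T b i x) = prob (space M - quiet T b i x)"
    by (simp add: prob_compl)
  also have "\<dots> \<le> prob ({\<omega> \<in> space M. b < \<eta> x \<omega>} \<union> (\<Union>j\<in>{..b}. ?D j))"
    by (rule finite_measure_mono) (auto simp: quiet_def not_less not_le)
  also have "\<dots> \<le> prob {\<omega> \<in> space M. b < \<eta> x \<omega>} + prob (\<Union>j\<in>{..b}. ?D j)"
    by (rule measure_Un_le) auto
  also have "prob (\<Union>j\<in>{..b}. ?D j) \<le> (\<Sum>j\<in>{..b}. prob (?D j))"
    by (rule finite_measure_subadditive_finite) auto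
  also have "(\<Sum>j\<in>{..b}. prob (?D j)) \<le> (\<Sum>j\<in>{..b}. T ^ i / fact i)"
    by (rule sum_mono) (rule prob_many_jumps[OF assms])
  finally show ?thesis by (simp add: prob_initial algebra_simps)
qed

text \<open>At small distances the union bound may be void, but the probability is positive all the
  same, since the particles may stay where they are.\<close>

lemma prob_quiet_ge_stay:
  assumes "0 \<le> T"
  shows "measure_pmf.prob \<mu> {n. n \<le> b} * exp (-T) ^ Suc b \<le> prob (quiet T b (Suc i) x)"
proof -
  let ?S = "\<lambda>j. {\<omega> \<in> space M. T < \<tau> x j 0 \<omega>}"
  let ?W = "{\<omega> \<in> space M. \<forall>j\<le>b. T < (\<Sum>k<Suc i. \<tau> x j k \<omega>)}"
  have "indep_events (\<lambda>p. {\<omega> \<in> space M. T < \<tau> (fst p) (fst (snd p)) (snd (snd p)) \<omega>}) UNIV"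
    using indep_eventsI_indep_vars[OF indep_steps, of "\<lambda>_ p. T < fst p"] by (simp add: case_prod_beta)
  from indep_events_reindex[OF this, of "\<lambda>j. (x, j, 0)"]
  have "indep_events ?S UNIV" by (simp add: inj_def)
  then have "prob (\<Inter>j\<in>{..b}. ?S j) = (\<Prod>j\<in>{..b}. prob (?S j))"
    by (rule prob_finite_Inter) auto
  then have "exp (-T) ^ Suc b = prob (\<Inter>j\<in>{..b}. ?S j)"
    using assms by (simp add: prob_holding_time_gt)
  also have "\<dots> \<le> prob ?W"
  proof (rule finite_measure_mono_AE)
    show "AE \<omega> in M. \<omega> \<in> (\<Inter>j\<in>{..b}. ?S j) \<longrightarrow> \<omega> \<in> ?W"
      using AE_regular_steps
    proof eventually_elim
      case (elim \<omega>)
      have "\<tau> x j 0 \<omega> \<le> (\<Sum>k<Suc i. \<tau> x j k \<omega>)" for j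
        using elim by (intro member_le_sum) (auto intro: less_imp_le)
      then have "T < (\<Sum>k<Suc i. \<tau> x j k \<omega>)" if "T < \<tau> x j 0 \<omega>" for j
        using that less_le_trans by blast
      then show ?case by (auto simp del: sum.lessThan_Suc)
    qed
  qed measurable
  finally have "prob {\<omega> \<in> space M. \<eta> x \<omega> \<le> b} * exp (-T) ^ Suc b \<le>
      prob {\<omega> \<in> space M. \<eta> x \<omega> \<le> b} * prob ?W"
    by (intro mult_left_mono) auto
  then show ?thesis
    using prob_Inter_quiet[of "{x}" T "\<lambda>_. b" "\<lambda>_. Suc i"]
    by (simp add: prob_initial[where P="\<lambda>n. n \<le> b"] del: sum.lessThan_Suc power_Suc)
qed

text \<open>The lower bounds are the maximum of the one from the union bound, whose defects are
  summable, and of the one from staying, which is positive. Shifting \<open>i\<close> by one turns the distance to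
  the centre \<open>m\<close> into the distance to the first site beyond it.\<close>

lemma exists_quiet_centre:
  assumes T: "0 \<le> T" and pos: "\<And>i. 0 < measure_pmf.prob \<mu> {n. n \<le> b i}"
    and sum: "summable (\<lambda>i. measure_pmf.prob \<mu> {n. b i < n} + (real (b i) + 1) * (T ^ i / fact i))"
  shows "AE \<omega> in M. \<exists>m\<ge>0. \<forall>i. \<omega> \<in> quiet T (b (Suc i)) (Suc i) (m - int i)" (is ?right)
    and "AE \<omega> in M. \<exists>m\<ge>0. \<forall>i. \<omega> \<in> quiet T (b (Suc i)) (Suc i) (- (m - int i))" (is ?left)
proof -
  define v where "v i = measure_pmf.prob \<mu> {n. b i < n} + (real (b i) + 1) * (T ^ i / fact i)" for i
  define c where "c i = measure_pmf.prob \<mu> {n. n \<le> b i} * exp (-T) ^ Suc (b i)" for i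
  define g where "g i = max (1 - v (Suc i)) (c (Suc i))" for i
  have low: "g i \<le> prob (quiet T (b (Suc i)) (Suc i) x)" for i x
    unfolding g_def v_def c_def
    by (intro max.boundedI prob_quiet_ge prob_quiet_ge_stay T)
  have "c i > 0" for i unfolding c_def using pos by simp
  then have g: "0 < g i" for i by (simp add: g_def less_max_iff_disj)
  have "1 - g i \<le> v (Suc i)" for i by (simp add: g_def)
  moreover have "g i \<le> 1" for i
    using low[of i 0] prob_le_1 by (rule order_trans)
  moreover have "summable (\<lambda>i. v (Suc i))"
    using sum unfolding v_def[symmetric] by (simp add: summable_Suc_iff)
  ultimately have sum_g: "summable (\<lambda>i. 1 - g i)"
    by (intro summable_comparison_test_ev[OF _ \<open>summable (\<lambda>i. v (Suc i))\<close>]) auto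
  show ?right
    by (rule exists_good_centre[where g=g]) (rule indep_quiet low g sum_g)+
  show ?left
  proof (rule exists_good_centre[where g=g and Q="\<lambda>i x. quiet T (b (Suc i)) (Suc i) (- x)"])
    fix d :: "int \<Rightarrow> nat"
    show "indep_events (\<lambda>x. quiet T (b (Suc (d x))) (Suc (d x)) (- x)) UNIV"
      using indep_events_reindex[OF indep_quiet[of T "\<lambda>x. b (Suc (d (- x)))" "\<lambda>x. Suc (d (- x))"], of uminus]
      by simp
  qed (rule low g sum_g)+
qed

text \<open>For every time horizon there is a barrier on each side of the origin, and
  integer horizons are enough.\<close>

lemma no_explosion_if_summable:
  assumes pos: "\<And>i. 0 < measure_pmf.prob \<mu> {n. n \<le> b i}"
    and sum: "\<And>T. 0 \<le> T \<Longrightarrow>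
      summable (\<lambda>i. measure_pmf.prob \<mu> {n. b i < n} + (real (b i) + 1) * (T ^ i / fact i))"
  shows "AE \<omega> in M. \<not> explosion \<eta> \<tau> \<xi> \<omega>"
proof -
  have "AE \<omega> in M. \<forall>N::nat. \<exists>m\<ge>0. \<forall>i. \<omega> \<in> quiet N (b (Suc i)) (Suc i) (m - int i)"
    unfolding AE_all_countable by (intro allI exists_quiet_centre(1) pos sum) simp_all
  moreover have "AE \<omega> in M. \<forall>N::nat. \<exists>m\<ge>0. \<forall>i. \<omega> \<in> quiet N (b (Suc i)) (Suc i) (- (m - int i))"
    unfolding AE_all_countable by (intro allI exists_quiet_centre(2) pos sum) simp_all
  ultimately show ?thesis
    using AE_regular_steps
  proof eventually_elim
    case (elim \<omega>)
    let ?c = "with_origin (\<lambda>x. \<eta> x \<omega>)"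
    let ?S = "\<lambda>x j. walk (\<lambda>k. \<tau> x j k \<omega>) (\<lambda>k. \<xi> x j k \<omega>)"
    have "finite (visited ?c ?S t)" for t
    proof -
      obtain N :: nat where N: "t < N" using reals_Archimedean2 by blast
      obtain r where r: "0 \<le> r" "\<And>i. \<omega> \<in> quiet N (b (Suc i)) (Suc i) (r - int i)" using elim(1) by blast
      obtain l where l: "0 \<le> l" "\<And>i. \<omega> \<in> quiet N (b (Suc i)) (Suc i) (- (l - int i))" using elim(2) by blast
      have short: "\<bar>?S x j u\<bar> < int i"
        if "\<omega> \<in> quiet N b' i x" "j < ?c x" "1 \<le> i" "u \<le> real N" for x j u i b'
      proof (rule abs_walk_less)
        have "?c x \<le> Suc (\<eta> x \<omega>)" by (simp add: with_origin_def)
        with that(1,2) show "real N < (\<Sum>k<i. \<tau> x j k \<omega>)"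
          by (auto simp: quiet_def)
        show "\<bar>\<xi> x j k \<omega>\<bar> \<le> 1" for k using elim(3) by (metis abs_1 abs_minus empty_iff insert_iff order_refl)
      qed (use elim that in auto)
      show ?thesis
      proof (rule finite_visited_if_confined[of "{-l..r}"])
        fix x j u assume x: "x \<in> {-l..r}" and *: "j < ?c x" "0 \<le> u" "u \<le> real N"
        have "\<bar>?S x j u\<bar> < int (Suc (nat (r - x)))"
          by (rule short[OF _ *(1) _ *(3)]) (use r(2)[of "nat (r - x)"] x in simp_all)
        moreover have "\<bar>?S x j u\<bar> < int (Suc (nat (l + x)))"
          by (rule short[OF _ *(1) _ *(3)]) (use l(2)[of "nat (l + x)"] x in simp_all)
        ultimately show "x + ?S x j u \<in> {-l..r}" using x by auto
      qed (use N r l in auto)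
    qed
    then show ?case by (simp add: explosion_def explodes_def)
  qed
qed

end


lemma recip_sum_eq: "recip_sum A i = (\<Sum>z<i. 1 / A (Suc z))"
  unfolding recip_sum_def using sum.atLeast_Suc_atMost_Suc_shift[of "\<lambda>z. 1 / A z" 0 "i - 1"]
  by (cases i) (auto simp: lessThan_Suc_atMost atLeast0AtMost)

lemma recip_sum_at_top:
  assumes A: "\<And>z. 1 \<le> z \<Longrightarrow> 0 < A z" and div: "\<not> summable (\<lambda>z. 1 / A (Suc z))"
  shows "filterlim (recip_sum A) at_top sequentially"
proof -
  have mono: "recip_sum A i \<le> recip_sum A j" if "i \<le> j" for i j
    unfolding recip_sum_def using that A by (intro sum_mono2) (auto intro: less_imp_le)
  have "\<exists>i. C \<le> recip_sum A i" for C
  proof (rule ccontr)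
    assume "\<nexists>i. C \<le> recip_sum A i"
    then have "(\<Sum>z\<le>i. 1 / A (Suc z)) \<le> C" for i
      unfolding recip_sum_eq lessThan_Suc_atMost[symmetric] by (meson linear)
    then have "summable (\<lambda>z. 1 / A (Suc z))"
      by (intro bounded_imp_summable[of _ C]) (simp_all add: A less_imp_le)
    then show False using div by simp
  qed
  then show ?thesis
    unfolding filterlim_at_top eventually_sequentially using mono by (meson order_trans)
qed

lemma (in frog_model) no_explosion:
  assumes A: "\<And>z. 1 \<le> z \<Longrightarrow> 0 < A z" and div: "\<not> summable (\<lambda>z. 1 / A (Suc z))"
    and sum: "summable (\<lambda>i. measure_pmf.prob \<mu> {n. threshold A i \<le> real n})"
  shows "AE \<omega> in M. \<not> explosion \<eta> \<tau> \<xi> \<omega>"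
proof -
  obtain K where K: "K \<in> set_pmf \<mu>" using set_pmf_not_empty[of \<mu>] by blast
  \<comment> \<open>\<open>K\<close> makes \<open>{..b i}\<close> have positive measure also if \<open>threshold A i\<close> is small\<close>
  define b where "b i = K + nat \<lceil>threshold A i\<rceil>" for i
  have recip: "0 \<le> recip_sum A i" for i
    unfolding recip_sum_def using A by (intro sum_nonneg) (auto intro: less_imp_le)
  then have thr: "0 \<le> threshold A i" for i by (simp add: threshold_def)
  show ?thesis
  proof (rule no_explosion_if_summable[of b])
    show "0 < measure_pmf.prob \<mu> {n. n \<le> b i}" for i
      using K by (intro measure_pmf_posI[of K]) (auto simp: b_def)
    fix T :: real assume T: "0 \<le> T"
    have "summable (\<lambda>i. measure_pmf.prob \<mu> {n. b i < n})"
    proof (rule summable_comparison_test_ev[OF _ sum], intro always_eventually allI)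
      fix i
      have "threshold A i \<le> real n" if "b i < n" for n
        using that thr[of i] by (simp add: b_def) linarith
      then show "norm (measure_pmf.prob \<mu> {n. b i < n}) \<le> measure_pmf.prob \<mu> {n. threshold A i \<le> real n}"
        by (auto intro!: measure_pmf.finite_measure_mono)
    qed
    moreover have "summable (\<lambda>i. (real (b i) + 1) * (T ^ i / fact i))"
    proof -
      have large: "eventually (\<lambda>i. 2 * T + 1 \<le> recip_sum A i) sequentially"
        using recip_sum_at_top[OF A div] unfolding filterlim_at_top by blast
      have "eventually (\<lambda>i. threshold A i * (T ^ i / fact i) \<le> (1/2) ^ i) sequentially"
        using large eventually_gt_at_top[of 0]
      proof eventually_elim
        case (elim i)
        then have "threshold A i * (T ^ i / fact i) = (T / recip_sum A i) ^ i"
          by (simp add: threshold_def power_divide)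
        also have "\<dots> \<le> (1/2) ^ i"
          using elim T by (intro power_mono) (auto simp: field_simps)
        finally show ?case .
      qed
      moreover have "summable (\<lambda>i. (1/2::real) ^ i)" by (rule summable_geometric) simp
      ultimately have "summable (\<lambda>i. threshold A i * (T ^ i / fact i))"
        using T thr by (elim summable_comparison_test_ev[rotated]) (auto elim!: eventually_mono)
      moreover have "summable (\<lambda>i. (real K + 2) * (T ^ i / fact i))"
        using summable_exp[of T] by (intro summable_mult) (simp add: divide_inverse mult.commute)
      ultimately have "summable (\<lambda>i. threshold A i * (T ^ i / fact i) + (real K + 2) * (T ^ i / fact i))"
        by (rule summable_add)
      then show ?thesis
      proof (rule summable_comparison_test_ev[rotated], intro always_eventually allI)
        fix i
        have "real (b i) + 1 \<le> threshold A i + (real K + 2)"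
          using thr[of i] by (simp add: b_def) linarith
        then have "(real (b i) + 1) * (T ^ i / fact i) \<le> (threshold A i + (real K + 2)) * (T ^ i / fact i)"
          using T by (intro mult_right_mono) auto
        moreover have "0 \<le> (real (b i) + 1) * (T ^ i / fact i)"
          using T by simp
        ultimately show "norm ((real (b i) + 1) * (T ^ i / fact i)) \<le>
            threshold A i * (T ^ i / fact i) + (real K + 2) * (T ^ i / fact i)"
          by (simp only: distrib_right real_norm_def abs_of_nonneg)
      qed
    qed
    ultimately show "summable (\<lambda>i. measure_pmf.prob \<mu> {n. b i < n} + (real (b i) + 1) * (T ^ i / fact i))"
      by (rule summable_add)
  qed
qed

section \<open>Explosions\<close>


text \<open>The delay \<open>i / A m\<close> between \<open>m - i\<close> and \<open>m\<close> is a sum of \<open>i\<close> terms \<open>1 / A m\<close>, which are at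
  most \<open>1 / A z\<close> for the sites \<open>z\<close> in between. So going back from \<open>m\<close> to \<open>m - i\<close>
  and so on, until a site below \<open>m0\<close> is met, costs at most \<open>recip_sum A m\<close> in total.\<close>

lemma explodes_if_quick_crossings:
  fixes A :: "nat \<Rightarrow> real" and h :: "int \<Rightarrow> nat \<Rightarrow> nat \<Rightarrow> real" and d :: "int \<Rightarrow> nat \<Rightarrow> nat \<Rightarrow> int"
  assumes A: "\<And>z. 1 \<le> z \<Longrightarrow> 0 < A z" and mono: "mono_on {1..} A"
    and S: "\<And>m. recip_sum A m \<le> S"
    and h: "\<And>x j k. 0 < h x j k" and c: "0 < c 0"
    and hits: "\<And>m::nat. \<exists>n. (\<Sum>k<n. d 0 0 k) = int m"
    and quick: "\<And>m. m0 \<le> m \<Longrightarrow> \<exists>i\<in>{1..m}. \<exists>j<c (int m - int i).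
      \<forall>k<i. h (int m - int i) j k \<le> 1 / A m \<and> d (int m - int i) j k = 1"
  shows "explodes c (\<lambda>x j. walk (h x j) (d x j))"
proof -
  let ?S = "\<lambda>x j. walk (h x j) (d x j)"
  have jump: "reached c ?S (x + (\<Sum>k<n. d x j k)) (s + (\<Sum>k<n. h x j k))"
    if "reached c ?S x s" "j < c x" for x j s n
    using that h by (intro reached.step) (auto simp: walk_at_jump_time less_imp_le intro!: sum_nonneg)
  have "\<exists>t. reached c ?S (int m) t" for m
  proof -
    obtain n where "(\<Sum>k<n. d 0 0 k) = int m" using hits by blast
    then show ?thesis using jump[OF reached.origin c, of n] by auto
  qed
  then obtain t where t: "\<And>m. reached c ?S (int m) (t m)" by metis
  \<comment> \<open>a time by which all sites below \<open>m0\<close> have been reached\<close>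
  define C where "C = (\<Sum>m<m0. t m)"
  have C: "t m \<le> C" if "m < m0" for m
    unfolding C_def using that reached_nonneg[OF t] by (intro member_le_sum) auto
  have C_nonneg: "0 \<le> C" unfolding C_def using reached_nonneg[OF t] by (intro sum_nonneg)
  have recip_nonneg: "0 \<le> recip_sum A m" for m
    unfolding recip_sum_def using A by (intro sum_nonneg) (auto intro: less_imp_le)
  have "\<exists>s\<le>C + recip_sum A m. reached c ?S (int m) s" for m
  proof (induction m rule: less_induct)
    case (less m)
    show ?case
    proof (cases "m < m0")
      case True
      then show ?thesis using C[of m] t[of m] recip_nonneg[of m] by (intro exI[of _ "t m"]) auto
    next
      case False
      then obtain i j where i: "1 \<le> i" "i \<le> m" and j: "j < c (int m - int i)"
        and step: "\<And>k. k < i \<Longrightarrow> h (int m - int i) j k \<le> 1 / A m"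
          "\<And>k. k < i \<Longrightarrow> d (int m - int i) j k = 1"
        using quick[of m] by auto
      have x: "int m - int i = int (m - i)" using i by simp
      obtain s where s: "s \<le> C + recip_sum A (m - i)" "reached c ?S (int (m - i)) s"
        using less.IH[of "m - i"] i by auto
      let ?s = "s + (\<Sum>k<i. h (int m - int i) j k)"
      have "reached c ?S (int m) ?s"
        using jump[OF s(2), of j i] j step(2) i unfolding x[symmetric] by simp
      moreover have "?s \<le> C + recip_sum A m"
      proof -
        have "(\<Sum>k<i. h (int m - int i) j k) \<le> (\<Sum>k<i. 1 / A m)"
          using step(1) by (intro sum_mono) auto
        also have "\<dots> = (\<Sum>z\<in>{m-i<..m}. 1 / A m)" using i by simp
        also have "\<dots> \<le> (\<Sum>z\<in>{m-i<..m}. 1 / A z)"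
          using A mono by (intro sum_mono divide_left_mono) (auto simp: mono_on_def)
        also have "recip_sum A (m - i) + \<dots> = recip_sum A m"
          unfolding recip_sum_def using i
          by (subst sum.union_disjoint[symmetric]) (auto intro!: sum.cong)
        finally show ?thesis using s(1) by linarith
      qed
      ultimately show ?thesis by blast
    qed
  qed
  moreover have "C + recip_sum A m \<le> C + S + 1" for m using S[of m] by simp
  ultimately have "\<exists>s\<le>C + S + 1. reached c ?S (int m) s" for m by (meson order_trans)
  moreover have "0 < C + S + 1" using C_nonneg recip_nonneg[of 0] S[of 0] by simp
  moreover have "?S 0 0 0 = 0"
    using walk_at_jump_time[of "h 0 0" "d 0 0" 0] h by simp
  ultimately show ?thesis using c by (intro explodes_if_reached[of c ?S "C + S + 1"]) auto
qed

lemma recip_sum_le_suminf: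
  assumes A: "\<And>z. 1 \<le> z \<Longrightarrow> 0 < A z" and sum: "summable (\<lambda>z. 1 / A (Suc z))"
  shows "recip_sum A m \<le> (\<Sum>z. 1 / A (Suc z))"
  unfolding recip_sum_eq using A sum by (intro sum_le_suminf) (auto intro: less_imp_le)

text \<open>By monotonicity, \<open>m / A m\<close> is at most the \<open>m\<close>-th partial sum of the series.\<close>

lemma linear_lower_bound:
  assumes A: "\<And>z. 1 \<le> z \<Longrightarrow> 0 < A z" and mono: "mono_on {1..} A"
    and sum: "summable (\<lambda>z. 1 / A (Suc z))"
  shows "\<exists>c>0. \<forall>m\<ge>1. c * real m \<le> A m"
proof -
  define S where "S = (\<Sum>z. 1 / A (Suc z))"
  have S: "recip_sum A m \<le> S" for m unfolding S_def by (rule recip_sum_le_suminf[OF A sum])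
  have "0 < recip_sum A 1" using A[of 1] by (simp add: recip_sum_def)
  with S[of 1] have "0 < S" by linarith
  have "1 / S * real m \<le> A m" if m: "1 \<le> m" for m
  proof -
    have "real m / A m = (\<Sum>z=1..m. 1 / A m)" by simp
    also have "\<dots> \<le> recip_sum A m"
      unfolding recip_sum_def using A mono
      by (intro sum_mono divide_left_mono) (auto simp: mono_on_def)
    also have "\<dots> \<le> S" by (rule S)
    finally show ?thesis using \<open>0 < S\<close> A[OF m] by (simp add: field_simps)
  qed
  then show ?thesis using \<open>0 < S\<close> by (intro exI[of _ "1 / S"]) auto
qed

lemma one_minus_exp_ge_half:
  fixes a :: real assumes "0 \<le> a" "a \<le> 1"
  shows "a / 2 \<le> 1 - exp (- a)"
proof -
  have "exp (-a) \<le> 1 / (1 + a)"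
    using exp_ge_add_one_self[of a] assms by (simp add: exp_minus field_simps)
  also have "\<dots> \<le> 1 - a / 2"
  proof -
    have "a * a \<le> a * 1" using assms by (intro mult_left_mono) auto
    then show ?thesis using assms by (simp add: field_simps)
  qed
  finally show ?thesis by simp
qed

context frog_model
begin


text \<open>The first \<open>i\<close> steps go to the right with short holding times. Bounding each holding
  time, and not only their sum, makes the probability a plain power.\<close>

definition quick :: "real \<Rightarrow> nat \<Rightarrow> int \<Rightarrow> nat \<Rightarrow> 'w \<Rightarrow> bool" where
  "quick a i x j \<omega> \<longleftrightarrow> (\<forall>k<i. \<tau> x j k \<omega> \<le> a \<and> \<xi> x j k \<omega> = 1)"

lemma quick_measurable[measurable]: "Measurable.pred M (quick a i x j)"
  unfolding quick_def by measurable

lemma prob_quick: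
  assumes a: "0 \<le> a" and i: "1 \<le> i"
  shows "prob {\<omega> \<in> space M. quick a i x j \<omega>} = ((1 - exp (-a)) / 2) ^ i"
proof -
  let ?F = "\<lambda>p. {\<omega> \<in> space M. \<tau> (fst p) (fst (snd p)) (snd (snd p)) \<omega> \<le> a \<and>
      \<xi> (fst p) (fst (snd p)) (snd (snd p)) \<omega> = 1}"
  have "indep_events ?F UNIV"
    using indep_eventsI_indep_vars[OF indep_steps, of "\<lambda>_ p. fst p \<le> a \<and> snd p = 1"]
    by (simp add: case_prod_beta)
  from indep_events_reindex[OF this, of "\<lambda>k. (x, j, k)"]
  have "indep_events (\<lambda>k. {\<omega> \<in> space M. \<tau> x j k \<omega> \<le> a \<and> \<xi> x j k \<omega> = 1}) UNIV"
    by (simp add: inj_def)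
  then have "prob (\<Inter>k\<in>{..<i}. {\<omega> \<in> space M. \<tau> x j k \<omega> \<le> a \<and> \<xi> x j k \<omega> = 1}) =
      (\<Prod>k\<in>{..<i}. prob {\<omega> \<in> space M. \<tau> x j k \<omega> \<le> a \<and> \<xi> x j k \<omega> = 1})"
    using i by (intro prob_finite_Inter) (auto simp: lessThan_empty_iff)
  moreover have "(\<Inter>k\<in>{..<i}. {\<omega> \<in> space M. \<tau> x j k \<omega> \<le> a \<and> \<xi> x j k \<omega> = 1}) = {\<omega> \<in> space M. quick a i x j \<omega>}"
  proof -
    have "0 \<in> {..<i}" using i by simp
    then show ?thesis by (simp only: quick_def lessThan_iff[symmetric]) blast
  qed
  ultimately show ?thesis by (simp add: prob_quick_right_step a)
qed

lemma prob_none_quick: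
  assumes a: "0 \<le> a" and i: "1 \<le> i"
  shows "prob {\<omega> \<in> space M. \<forall>j\<le>K. \<not> quick a i x j \<omega>} \<le> exp (- (real (Suc K) * ((1 - exp (-a)) / 2) ^ i))"
proof -
  let ?N = "\<lambda>_::int\<times>nat\<times>nat. (borel::real measure) \<Otimes>\<^sub>M count_space (UNIV::int set)"
  let ?X = "\<lambda>(x, j, k) \<omega>. (\<tau> x j k \<omega>, \<xi> x j k \<omega>)"
  let ?C = "\<lambda>j::nat. {x} \<times> {j} \<times> (UNIV::nat set)"
  have "indep_vars (\<lambda>j. PiM (?C j) ?N) (\<lambda>j \<omega>. restrict (\<lambda>p. ?X p \<omega>) (?C j)) UNIV"
    by (rule indep_vars_restrict[OF indep_steps]) (auto simp: disjoint_family_on_def)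
  then have "indep_events (\<lambda>j. {\<omega> \<in> space M.
      \<not> (\<forall>k<i. fst (restrict (\<lambda>p. ?X p \<omega>) (?C j) (x, j, k)) \<le> a \<and>
          snd (restrict (\<lambda>p. ?X p \<omega>) (?C j) (x, j, k)) = 1)}) UNIV"
    by (rule indep_eventsI_indep_vars) measurable
  then have "indep_events (\<lambda>j. {\<omega> \<in> space M. \<not> quick a i x j \<omega>}) UNIV"
    by (simp add: quick_def)
  then have "prob (\<Inter>j\<in>{..K}. {\<omega> \<in> space M. \<not> quick a i x j \<omega>}) =
      (\<Prod>j\<in>{..K}. prob {\<omega> \<in> space M. \<not> quick a i x j \<omega>})"
    by (rule prob_finite_Inter) auto
  moreover have "(\<Inter>j\<in>{..K}. {\<omega> \<in> space M. \<not> quick a i x j \<omega>}) = {\<omega> \<in> space M. \<forall>j\<le>K. \<not> quick a i x j \<omega>}"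
    by auto
  moreover have "prob {\<omega> \<in> space M. \<not> quick a i x j \<omega>} = 1 - ((1 - exp (-a)) / 2) ^ i" for j
    using prob_neg[of "quick a i x j"] prob_quick[OF a i, of x j] by simp
  ultimately have "prob {\<omega> \<in> space M. \<forall>j\<le>K. \<not> quick a i x j \<omega>} = (1 - ((1 - exp (-a)) / 2) ^ i) ^ Suc K"
    by simp
  also have "\<dots> \<le> exp (- (((1 - exp (-a)) / 2) ^ i)) ^ Suc K"
  proof (rule power_mono)
    show "1 - ((1 - exp (-a)) / 2) ^ i \<le> exp (- (((1 - exp (-a)) / 2) ^ i))"
      using exp_ge_add_one_self[of "- (((1 - exp (-a)) / 2) ^ i)"] by simp
    show "0 \<le> 1 - ((1 - exp (-a)) / 2) ^ i"
      using prob_le_1[of "{\<omega> \<in> space M. quick a i x 0 \<omega>}"] unfolding prob_quick[OF a i] by simp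
  qed
  also have "\<dots> = exp (- (real (Suc K) * ((1 - exp (-a)) / 2) ^ i))"
    unfolding exp_of_nat_mult[symmetric] by simp
  finally show ?thesis .
qed

text \<open>Each of the at least \<open>r powr (\<rho> * i)\<close> particles is quick with probability at least
  \<open>(1 / (4 * r)) ^ i\<close>, so the expected number of quick ones is at least
  \<open>(r powr (\<rho> - 1) / 4) ^ i\<close>. The hypothesis on \<open>r\<close> makes the base at least \<open>1\<close>, and the bound uniform
  in the distance.\<close>

lemma prob_none_quick_powr:
  assumes r: "1 \<le> r" and big: "4 \<le> r powr (\<rho> - 1)" and i: "1 \<le> i"
  shows "prob {\<omega> \<in> space M. \<forall>j\<le>nat \<lfloor>r powr (\<rho> * real i)\<rfloor>. \<not> quick (1 / r) i x j \<omega>}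
    \<le> exp (- (r powr (\<rho> - 1) / 4))"
proof -
  let ?K = "nat \<lfloor>r powr (\<rho> * real i)\<rfloor>"
  have q: "1 / (4 * r) \<le> (1 - exp (- (1 / r))) / 2"
    using one_minus_exp_ge_half[of "1 / r"] r by simp
  have "r powr (\<rho> - 1) / 4 \<le> (r powr (\<rho> - 1) / 4) ^ i"
    using big i by (intro self_le_power) auto
  also have "\<dots> = r powr (\<rho> * real i) * (1 / (4 * r)) ^ i"
    using r by (simp add: powr_diff power_divide power_mult_distrib powr_powr[symmetric] powr_realpow[symmetric] powr_power)
  also have "\<dots> \<le> real (Suc ?K) * ((1 - exp (- (1 / r))) / 2) ^ i"
  proof (rule mult_mono)
    show "r powr (\<rho> * real i) \<le> real (Suc ?K)"
      using powr_ge_zero[of r "\<rho> * real i"] by simp linarith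
    show "(1 / (4 * r)) ^ i \<le> ((1 - exp (- (1 / r))) / 2) ^ i"
      using q r by (intro power_mono) auto
  qed (use r in auto)
  finally have le: "exp (- (real (Suc ?K) * ((1 - exp (- (1 / r))) / 2) ^ i)) \<le> exp (- (r powr (\<rho> - 1) / 4))"
    by simp
  show ?thesis
    by (rule order_trans[OF prob_none_quick le]) (use r i in auto)
qed

lemma prob_all_initial_le:
  assumes m: "1 \<le> m"
  shows "prob {\<omega> \<in> space M. \<forall>i\<in>{1..m}. real (\<eta> (int m - int i) \<omega>) \<le> B i} =
    (\<Prod>i=1..m. measure_pmf.prob \<mu> {n. real n \<le> B i})"
proof -
  let ?F = "\<lambda>i. {\<omega> \<in> space M. real (\<eta> (int m - int i) \<omega>) \<le> B i}"
  have "indep_events (\<lambda>x. {\<omega> \<in> space M. real (\<eta> x \<omega>) \<le> B (nat (int m - x))}) UNIV"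
    by (rule indep_eventsI_indep_vars[OF indep_initial]) auto
  from indep_events_reindex[OF this, of "\<lambda>i. int m - int i"]
  have "indep_events ?F UNIV" by (simp add: inj_def)
  then have "prob (\<Inter>i\<in>{1..m}. ?F i) = (\<Prod>i\<in>{1..m}. prob (?F i))"
    using m by (intro prob_finite_Inter) auto
  moreover have "(\<Inter>i\<in>{1..m}. ?F i) = {\<omega> \<in> space M. \<forall>i\<in>{1..m}. real (\<eta> (int m - int i) \<omega>) \<le> B i}"
    using m by auto
  ultimately show ?thesis
    by (simp add: prob_initial[where P="\<lambda>n. real n \<le> C" for C])
qed

lemma explosion_if_summable:
  fixes A :: "nat \<Rightarrow> real"
  assumes A: "\<And>z. 1 \<le> z \<Longrightarrow> 0 < A z" and mono: "mono_on {1..} A"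
    and sum: "summable (\<lambda>z. 1 / A (Suc z))" and \<rho>: "1 < \<rho>"
    and sum_prod: "summable (\<lambda>m. \<Prod>i=1..Suc m.
      measure_pmf.prob \<mu> {n. real n \<le> A (Suc m) powr (\<rho> * real i)})"
  shows "AE \<omega> in M. explosion \<eta> \<tau> \<xi> \<omega>"
proof -
  obtain c where c: "0 < c" "\<And>m. 1 \<le> m \<Longrightarrow> c * real m \<le> A m"
    using linear_lower_bound[OF A mono sum] by blast
  \<comment> \<open>Borel--Cantelli excludes both ways in which a large \<open>m\<close> can fail. The event \<open>slow m\<close> refers
     to a fixed number of walks at each site, whether or not there are as many particles, so that
     its probability does not involve \<open>\<eta>\<close>.\<close>
  define few where "few m = {\<omega> \<in> space M. \<forall>i\<in>{1..m}. real (\<eta> (int m - int i) \<omega>) \<le> A m powr (\<rho> * real i)}" for m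
  define slow where "slow m = (\<Union>i\<in>{1..m}. {\<omega> \<in> space M.
      \<forall>j\<le>nat \<lfloor>A m powr (\<rho> * real i)\<rfloor>. \<not> quick (1 / A m) i (int m - int i) j \<omega>})" for m
  have "AE \<omega> in M. eventually (\<lambda>m. \<omega> \<in> space M - few (Suc m)) sequentially"
  proof (rule borel_cantelli_AE1)
    show "few (Suc m) \<in> events" for m unfolding few_def by measurable
    have "prob (few (Suc m)) = (\<Prod>i=1..Suc m. measure_pmf.prob \<mu> {n. real n \<le> A (Suc m) powr (\<rho> * real i)})" for m
      unfolding few_def by (rule prob_all_initial_le) simp
    then show "summable (\<lambda>m. prob (few (Suc m)))" using sum_prod by simp
  qed (auto simp: less_top[symmetric])
  moreover have "AE \<omega> in M. eventually (\<lambda>m. \<omega> \<in> space M - slow (Suc m)) sequentially"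
  proof (rule borel_cantelli_AE1)
    show "slow (Suc m) \<in> events" for m unfolding slow_def by measurable
    define \<delta> where "\<delta> = \<rho> - 1"
    have \<delta>: "0 < \<delta>" using \<rho> by (simp add: \<delta>_def)
    have "eventually (\<lambda>m. 1 \<le> c * real m \<and> 4 \<le> (c * real m) powr \<delta>) sequentially"
      using c(1) \<delta> by (intro eventually_conj) real_asymp+
    then have "eventually (\<lambda>m. prob (slow m) \<le> real m * exp (- ((c * real m) powr \<delta> / 4))) sequentially"
      using eventually_ge_at_top[of 1]
    proof eventually_elim
      case (elim m)
      have Am: "c * real m \<le> A m" using c elim by auto
      have powr: "(c * real m) powr \<delta> \<le> A m powr \<delta>"
        using Am elim \<delta> by (intro powr_mono2) auto
      have "prob (slow m) \<le> (\<Sum>i\<in>{1..m}. prob {\<omega> \<in> space M.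
          \<forall>j\<le>nat \<lfloor>A m powr (\<rho> * real i)\<rfloor>. \<not> quick (1 / A m) i (int m - int i) j \<omega>})"
        unfolding slow_def by (rule finite_measure_subadditive_finite) auto
      also have "\<dots> \<le> (\<Sum>i\<in>{1..m}. exp (- (A m powr (\<rho> - 1) / 4)))"
        using Am powr elim by (intro sum_mono prob_none_quick_powr) (auto simp: \<delta>_def)
      also have "\<dots> \<le> real m * exp (- ((c * real m) powr \<delta> / 4))"
        using powr by (simp add: \<delta>_def mult_left_mono)
      finally show ?case .
    qed
    moreover have "summable (\<lambda>m. real m * exp (- ((c * real m) powr \<delta> / 4)))"
    proof (rule summable_comparison_test_bigo)
      show "summable (\<lambda>m. norm (1 / real m ^ 2))"
        using inverse_power_summable[of 2, where 'a=real] by (simp add: divide_inverse)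
      show "(\<lambda>m. real m * exp (- ((c * real m) powr \<delta> / 4))) \<in> O(\<lambda>m. 1 / real m ^ 2)"
        using c(1) \<delta> by real_asymp
    qed
    ultimately have "summable (\<lambda>m. prob (slow m))"
      by (elim summable_comparison_test_ev[rotated]) (auto elim: eventually_mono)
    then show "summable (\<lambda>m. prob (slow (Suc m)))" by (subst summable_Suc_iff)
  qed (auto simp: less_top[symmetric])
  ultimately show ?thesis
    using AE_regular_steps AE_origin_particle_hits
  proof eventually_elim
    case (elim \<omega>)
    obtain m1 where m1: "\<And>m. m1 \<le> m \<Longrightarrow> \<omega> \<in> space M - few (Suc m)"
      using elim(1) by (auto simp: eventually_sequentially)
    obtain m2 where m2: "\<And>m. m2 \<le> m \<Longrightarrow> \<omega> \<in> space M - slow (Suc m)"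
      using elim(2) by (auto simp: eventually_sequentially)
    let ?c = "with_origin (\<lambda>x. \<eta> x \<omega>)"
    show ?case
      unfolding explosion_def
    proof (rule explodes_if_quick_crossings[where A=A and S="\<Sum>z. 1 / A (Suc z)" and ?m0.0="Suc (max m1 m2)"])
      show "recip_sum A m \<le> (\<Sum>z. 1 / A (Suc z))" for m
        by (rule recip_sum_le_suminf[OF A sum])
      show "0 < ?c 0" by (simp add: with_origin_def)
      show "0 < \<tau> x j k \<omega>" for x j k using elim(3) by blast
      show "\<exists>n. (\<Sum>k<n. \<xi> 0 0 k \<omega>) = int m" for m using elim(4) by blast
      fix m assume "Suc (max m1 m2) \<le> m"
      then obtain m' where m': "m = Suc m'" "m1 \<le> m'" "m2 \<le> m'" by (cases m) auto
      then have few: "\<omega> \<in> space M - few m" and slow: "\<omega> \<in> space M - slow m"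
        using m1[of m'] m2[of m'] by auto
      from few obtain i where i: "i \<in> {1..m}" "A m powr (\<rho> * real i) < real (\<eta> (int m - int i) \<omega>)"
        by (auto simp: few_def not_le)
      with slow obtain j where j: "j \<le> nat \<lfloor>A m powr (\<rho> * real i)\<rfloor>" "quick (1 / A m) i (int m - int i) j \<omega>"
        unfolding slow_def by blast
      have "real j \<le> A m powr (\<rho> * real i)"
        using j(1) powr_ge_zero[of "A m" "\<rho> * real i"] by linarith
      then have "j < \<eta> (int m - int i) \<omega>" using i(2) by linarith
      moreover have "\<eta> (int m - int i) \<omega> \<le> ?c (int m - int i)" by (simp add: with_origin_def)
      ultimately have "j < ?c (int m - int i)" by simp
      then show "\<exists>i\<in>{1..m}. \<exists>j<?c (int m - int i).
          \<forall>k<i. \<tau> (int m - int i) j k \<omega> \<le> 1 / A m \<and> \<xi> (int m - int i) j k \<omega> = 1"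
        using i(1) j(2) unfolding quick_def by blast
    qed (rule A mono, assumption?)+
  qed
qed

end


theorem theorem2p1:
  fixes A :: "nat \<Rightarrow> real"
    and M :: "'w measure"
    and \<mu> :: "nat pmf"
    and \<eta> :: "int \<Rightarrow> 'w \<Rightarrow> nat"
    and \<tau> :: "int \<Rightarrow> nat \<Rightarrow> nat \<Rightarrow> 'w \<Rightarrow> real"
    and \<xi> :: "int \<Rightarrow> nat \<Rightarrow> nat \<Rightarrow> 'w \<Rightarrow> int"
  assumes "\<And>z. 1 \<le> z \<Longrightarrow> 0 < A z"
    and "mono_on {1..} A"
    and "measure_pmf.prob \<mu> {0} < 1"
    and "frog_model M \<mu> \<eta> \<tau> \<xi>"
  shows "(\<not> summable (\<lambda>z. 1 / A (Suc z)) \<and>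
          summable (\<lambda>i. measure_pmf.prob \<mu> {n. threshold A i \<le> real n})
          \<longrightarrow> (AE \<omega> in M. \<not> explosion \<eta> \<tau> \<xi> \<omega>))
       \<and> (summable (\<lambda>z. 1 / A (Suc z)) \<and>
          (\<exists>\<rho>>1. summable (\<lambda>m. \<Prod>i=1..Suc m.
             measure_pmf.prob \<mu> {n. real n \<le> A (Suc m) powr (\<rho> * real i)}))
          \<longrightarrow> (AE \<omega> in M. explosion \<eta> \<tau> \<xi> \<omega>))"
proof -
  interpret frog_model M \<mu> \<eta> \<tau> \<xi> by fact
  show ?thesis
  proof (intro conjI impI; elim conjE exE)
    assume "\<not> summable (\<lambda>z. 1 / A (Suc z))"
      and "summable (\<lambda>i. measure_pmf.prob \<mu> {n. threshold A i \<le> real n})"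
    with assms(1) show "AE \<omega> in M. \<not> explosion \<eta> \<tau> \<xi> \<omega>"
      by (rule no_explosion)
  next
    fix \<rho> :: real
    assume "summable (\<lambda>z. 1 / A (Suc z))" and "1 < \<rho>"
      and "summable (\<lambda>m. \<Prod>i=1..Suc m.
             measure_pmf.prob \<mu> {n. real n \<le> A (Suc m) powr (\<rho> * real i)})"
    with assms(1,2) show "AE \<omega> in M. explosion \<eta> \<tau> \<xi> \<omega>"
      by (rule explosion_if_summable)
  qed
qed

end
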